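(* There is no universal $K_\sigma$ subgroup of $H_+([0,1])^{\mathbb N}$. That is, writing $G = H_+([0,1])^{\mathbb N}$, there is no $K_\sigma$ subgroup $L \subseteq G$ such that for every $K_\sigma$ subgroup $H \subseteq G$ there exists a continuous group homomorphism $\varphi : G \to G$ with $H = \varphi^{-1}[L]$.
   Context: $H_+([0,1])$ denotes the group, under composition, of increasing homeomorphisms of the unit interval $[0,1]$; it is a Polish group with the topology of uniform convergence (which coincides on it with the topology of pointwise convergence). $H_+([0,1])^{\mathbb N}$ is its countable power, with coordinatewise operations and the product topology. A subset of a topological space is $K_\sigma$ if it is a countable union of compact sets. For subgroups $H, L$ of a Polish group $G$, $H$ is group homomorphism reducible to $L$ (written $H \leq_{\mathrm g} L$) iff there is a continuous group homomorphism $\varphi : G \to G$ with $H = \varphi^{-1}[L]$. A universal $K_\sigma$ subgroup of $G$ is a $K_\sigma$ subgroup $L$ of $G$ such that $H \leq_{\mathrm g} L$ for every $K_\sigma$ subgroup $H$ of $G$. *)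

theory Defs
  imports "HOL-Analysis.Analysis" "HOL-Algebra.Algebra"
begin

text \<open>
  \<open>BijGroup {0..1}\<close> composes self-maps of the unit interval that are \<open>undefined\<close> outside it, so
  that equality of maps is equality on \<open>{0..1}\<close>.
\<close>

definition inc_homeo :: "(real \<Rightarrow> real) set"
  where "inc_homeo =
    {f \<in> extensional {0..1}. strict_mono_on {0..1} f \<and> (\<exists>g. homeomorphism {0..1} {0..1} f g)}"

definition H_plus :: "(real \<Rightarrow> real) monoid"
  where "H_plus = BijGroup {0..1} \<lparr>carrier := inc_homeo\<rparr>"

text \<open>Uniform convergence: \<open>cfunspace\<close> carries the supremum metric.\<close>

definition H_plus_top :: "(real \<Rightarrow> real) topology"
  where "H_plus_top =
    subtopology (mtopology_of (cfunspace (top_of_set {0..1}) euclidean_metric)) inc_homeo"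

definition H_plus_N :: "(nat \<Rightarrow> real \<Rightarrow> real) monoid"
  where "H_plus_N = product_group UNIV (\<lambda>_. H_plus)"

definition H_plus_N_top :: "(nat \<Rightarrow> real \<Rightarrow> real) topology"
  where "H_plus_N_top = product_topology (\<lambda>_. H_plus_top) UNIV"

definition K_sigma_in :: "'a topology \<Rightarrow> 'a set \<Rightarrow> bool"
  where "K_sigma_in T = countable union_of compactin T"

definition K_sigma_subgroup :: "'a set \<Rightarrow> ('a, 'b) monoid_scheme \<Rightarrow> 'a topology \<Rightarrow> bool"
  where "K_sigma_subgroup H G T \<longleftrightarrow> subgroup H G \<and> K_sigma_in T H"

definition group_hom_reducible ::
    "('a, 'b) monoid_scheme \<Rightarrow> 'a topology \<Rightarrow> 'a set \<Rightarrow> 'a set \<Rightarrow> bool"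
  where "group_hom_reducible G T H L \<longleftrightarrow>
    (\<exists>\<phi> \<in> hom G G. continuous_map T T \<phi> \<and> H = {x \<in> carrier G. \<phi> x \<in> L})"

definition universal_K_sigma_subgroup ::
    "'a set \<Rightarrow> ('a, 'b) monoid_scheme \<Rightarrow> 'a topology \<Rightarrow> bool"
  where "universal_K_sigma_subgroup L G T \<longleftrightarrow>
    K_sigma_subgroup L G T \<and>
    (\<forall>H. K_sigma_subgroup H G T \<longrightarrow> group_hom_reducible G T H L)"

lemma inc_homeo_subset_Bij: "inc_homeo \<subseteq> Bij {0..1}"
  by (auto simp: inc_homeo_def Bij_def homeomorphism_def bij_betw_def strict_mono_on_imp_inj_on)

lemma mult_H_plus:
  assumes "f \<in> inc_homeo" "g \<in> inc_homeo"
  shows "f \<otimes>\<^bsub>H_plus\<^esub> g = compose {0..1} f g"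
  using assms inc_homeo_subset_Bij by (auto simp: H_plus_def BijGroup_def)

lemma id_inc_homeo: "(\<lambda>x\<in>{0..1}. x) \<in> inc_homeo"
proof -
  have "homeomorphism {0..1::real} {0..1} (\<lambda>x\<in>{0..1}. x) (\<lambda>x. x)"
    by (auto simp: homeomorphism_def cong: continuous_on_cong_simp)
  then show ?thesis by (auto simp: inc_homeo_def strict_mono_on_def)
qed

lemma compose_inc_homeo:
  assumes "f \<in> inc_homeo" "g \<in> inc_homeo"
  shows "compose {0..1} f g \<in> inc_homeo"
proof -
  obtain f' g' where h: "homeomorphism {0..1} {0..1} f f'" "homeomorphism {0..1} {0..1} g g'"
    using assms by (auto simp: inc_homeo_def)
  have "homeomorphism {0..1} {0..1} (compose {0..1} f g) (g' \<circ> f')"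
    using homeomorphism_compose[OF h(2,1)]
    by (rule homeomorphism_cong) (auto simp: compose_def)
  moreover have "strict_mono_on {0..1} (compose {0..1} f g)"
  proof (rule strict_mono_onI)
    fix x y :: real assume xy: "x \<in> {0..1}" "y \<in> {0..1}" "x < y"
    have i: "g x \<in> {0..1}" "g y \<in> {0..1}" using h(2) xy by (auto simp: homeomorphism_def)
    have "g x < g y" using assms(2) xy by (auto simp: inc_homeo_def intro: strict_mono_onD)
    with i have "f (g x) < f (g y)"
      using assms(1) by (auto simp: inc_homeo_def intro: strict_mono_onD[of "{0..1}" f])
    then show "compose {0..1} f g x < compose {0..1} f g y" using xy by (simp add: compose_eq)
  qed
  ultimately show ?thesis by (auto simp: inc_homeo_def)
qed

lemma inverse_inc_homeo:
  assumes "f \<in> inc_homeo"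
  shows "restrict (inv_into {0..1} f) {0..1} \<in> inc_homeo"
proof -
  obtain f' where h: "homeomorphism {0..1} {0..1} f f'" and m: "strict_mono_on {0..1} f"
    using assms by (auto simp: inc_homeo_def)
  have inj: "inj_on f {0..1}" using m by (rule strict_mono_on_imp_inj_on)
  have eq: "inv_into {0..1} f y = f' y" if "y \<in> {0..1}" for y
  proof (rule inv_into_f_eq[OF inj])
    show "f' y \<in> {0..1}" using h that by (auto simp: homeomorphism_def)
    show "f (f' y) = y" using h that by (auto simp: homeomorphism_def)
  qed
  have "homeomorphism {0..1} {0..1} (restrict (inv_into {0..1} f) {0..1}) f"
    using homeomorphism_symD[OF h] by (rule homeomorphism_cong) (auto simp: eq)
  moreover have "strict_mono_on {0..1} f'"
  proof (rule strict_mono_onI)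
    fix x y :: real assume xy: "x \<in> {0..1}" "y \<in> {0..1}" "x < y"
    have i: "f' x \<in> {0..1}" "f' y \<in> {0..1}" "f (f' x) = x" "f (f' y) = y"
      using h xy by (auto simp: homeomorphism_def)
    show "f' x < f' y"
      using strict_mono_onD[OF m i(2,1)] i(3,4) xy(3) by (metis linorder_neqE not_less_iff_gr_or_eq)
  qed
  then have "strict_mono_on {0..1} (restrict (inv_into {0..1} f) {0..1})"
    by (auto simp: strict_mono_on_def eq)
  ultimately show ?thesis by (auto simp: inc_homeo_def)
qed

lemma group_H_plus: "group H_plus"
proof -
  interpret B: group "BijGroup {0..1::real}" by (rule group_BijGroup)
  have "subgroup inc_homeo (BijGroup {0..1})"
  proof (rule B.subgroupI)
    show "inc_homeo \<subseteq> carrier (BijGroup {0..1})"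
      using inc_homeo_subset_Bij by (simp add: BijGroup_def)
    show "inc_homeo \<noteq> {}" using id_inc_homeo by blast
    show "inv\<^bsub>BijGroup {0..1}\<^esub> f \<in> inc_homeo" if "f \<in> inc_homeo" for f
      using that inverse_inc_homeo inc_homeo_subset_Bij by (auto simp: inv_BijGroup)
    show "f \<otimes>\<^bsub>BijGroup {0..1}\<^esub> g \<in> inc_homeo" if "f \<in> inc_homeo" "g \<in> inc_homeo" for f g
      using mult_H_plus[OF that] compose_inc_homeo[OF that] by (simp add: H_plus_def)
  qed
  then show ?thesis unfolding H_plus_def by (rule B.subgroup_imp_group)
qed

lemma group_H_plus_N: "group H_plus_N"
  unfolding H_plus_N_def by (simp add: group_H_plus)

lemma topspace_H_plus_top: "topspace H_plus_top = carrier H_plus"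
proof -
  have "f \<in> mspace (cfunspace (top_of_set {0..1}) euclidean_metric)" if "f \<in> inc_homeo" for f
  proof -
    have c: "continuous_on {0..1} f" "f \<in> extensional {0..1}" "f ` {0..1} = {0..1}"
      using that by (auto simp: inc_homeo_def homeomorphism_def)
    have "Met_TC.mbounded {0..1::real}"
      by (rule Met_TC.compactin_imp_mbounded) simp
    with c show ?thesis by simp
  qed
  then show ?thesis by (auto simp: H_plus_top_def H_plus_def)
qed

lemma topspace_H_plus_N_top: "topspace H_plus_N_top = carrier H_plus_N"
  by (simp add: H_plus_N_top_def H_plus_N_def topspace_H_plus_top)

end

theory Submission
  imports Defs
begin

text \<open>
  Every attempt to reduce a suitable \<open>K_\<sigma>\<close> subgroup to a given \<open>K_\<sigma>\<close> subgroup \<open>L\<close> is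
  defeated by growth: membership of \<open>\<phi>(x)\<close> in a compact set bounds the modulus of continuity of
  every coordinate of \<open>\<phi>(x)\<close>, and the elements of the former can be chosen wilder than all of the countably
  many moduli that occur in \<open>L\<close>.

  Let \<open>T\<^sub>t\<close> be a one-parameter group of homeomorphisms of \<open>[0,1]\<close> (\<open>flow\<close>), and let \<open>a\<close> be a
  homeomorphism with a very steep fixed point at \<open>1/2\<close>. They lie in a \<open>K_\<sigma>\<close> subgroup \<open>\<Gamma>\<close> of
  \<open>H_+\<close>, and the copy \<open>H\<close> of \<open>\<Gamma>\<close> in the first factor of the power is a \<open>K_\<sigma>\<close> subgroup of the
  power. Suppose \<open>H = \<phi>\<^sup>-\<^sup>1[L]\<close>, and let \<open>\<psi>\<close> be a coordinate of \<open>\<phi>\<close> restricted to the first factor.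

  By Baire's theorem some interval of times is mapped into one compact part of \<open>L\<close>. For such times
  the maps \<open>\<psi>(T\<^sub>-\<^sub>t)\<close> are equicontinuous, and this forces \<open>\<psi>(T\<^sub>d)\<close> to be uniformly close to the identity at
  a rate that depends on the modulus only: the intervals between consecutive points of an orbit of
  \<open>\<psi>(T\<^sub>d)\<close> do not overlap, so many steps cannot all be long, and the maps \<open>\<psi>(T\<^sub>-\<^sub>t)\<close> carry a short one
  back to the first (\<open>moved_at_most_one_parameter\<close>). On the other side,
  conjugating \<open>T\<^sub>d\<close> by \<open>a\<close> gives a map that moves \<open>1/2\<close> much further than \<open>T\<^sub>d\<close> does, and a product of such conjugates (\<open>sweep\<close>) moves a fixed
  interval \<open>J\<close> off itself. As \<open>\<psi>(a)\<close> also has a controlled modulus and \<open>d\<close> is chosen tiny compared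
  with the number of factors, the images of these products under \<open>\<psi>\<close> tend to the identity.

  If \<open>u\<close> moves \<open>J\<close> off itself, then \<open>g\<close> commutes with \<open>u h u\<^sup>-\<^sup>1\<close> for all \<open>g\<close>, \<open>h\<close> supported in \<open>J\<close>; letting
  \<open>\<psi>(u)\<close> tend to the identity, \<open>\<psi>(g)\<close> commutes with \<open>\<psi>(h)\<close> (\<open>ex_collapsing_element\<close>). The interval
  \<open>J\<close> does not depend on the coordinate, so \<open>\<phi>\<close> kills every commutator \<open>[g,h]\<close>, and all of them
  belong to \<open>\<Gamma>\<close>. This is absurd, because the commutators of homeomorphisms supported in \<open>J\<close> are not
  contained in any \<open>K_\<sigma>\<close> set (\<open>ex_commutator_outside_K_sigma\<close>).
\<close>

section \<open>Increasing homeomorphisms and uniform convergence\<close>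

lemma carrier_H_plus [simp]: "carrier H_plus = inc_homeo"
  by (simp add: H_plus_def)

lemma one_H_plus_apply: "x \<in> {0..1} \<Longrightarrow> \<one>\<^bsub>H_plus\<^esub> x = x"
  by (simp add: H_plus_def BijGroup_def)

interpretation HP: group H_plus
  by (rule group_H_plus)

lemma inc_homeo_strict_mono:
  assumes "f \<in> inc_homeo" "x \<in> {0..1}" "y \<in> {0..1}" "x < y"
  shows "f x < f y"
  using assms by (auto simp: inc_homeo_def intro: strict_mono_onD)

lemma inc_homeo_less_iff:
  assumes "f \<in> inc_homeo" "x \<in> {0..1}" "y \<in> {0..1}"
  shows "f x < f y \<longleftrightarrow> x < y"
  using assms inc_homeo_strict_mono by (metis linorder_neqE_linordered_idom not_less_iff_gr_or_eq)

lemma inc_homeo_le_iff: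
  assumes "f \<in> inc_homeo" "x \<in> {0..1}" "y \<in> {0..1}"
  shows "f x \<le> f y \<longleftrightarrow> x \<le> y"
  using inc_homeo_less_iff[OF assms(1,3,2)] by (simp add: not_less[symmetric])

lemma inc_homeo_in:
  assumes "f \<in> inc_homeo" "x \<in> {0..1}"
  shows "f x \<in> {0..1}"
  using assms by (auto simp: inc_homeo_def homeomorphism_def)

lemma inc_homeo_continuous: "f \<in> inc_homeo \<Longrightarrow> continuous_on {0..1} f"
  by (auto simp: inc_homeo_def homeomorphism_def)

lemma inc_homeo_eqI:
  assumes "f \<in> inc_homeo" "g \<in> inc_homeo" "\<And>x. x \<in> {0..1} \<Longrightarrow> f x = g x"
  shows "f = g"
  using assms by (auto simp: inc_homeo_def intro: extensionalityI)

lemma inc_homeoI: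
  assumes mono: "\<And>x y. x \<in> {0..1} \<Longrightarrow> y \<in> {0..1} \<Longrightarrow> x < y \<Longrightarrow> f x < f y"
    and cont: "continuous_on {0..1} f" and ends: "f 0 = 0" "f 1 = (1::real)"
  shows "restrict f {0..1} \<in> inc_homeo"
proof -
  have m: "strict_mono_on {0..1} f" using mono by (auto simp: strict_mono_on_def)
  have "f x \<in> {0..1}" if "x \<in> {0..1}" for x
    using that mono[of 0 x] mono[of x 1] ends by (cases "x = 0"; cases "x = 1") auto
  moreover have "\<exists>x\<in>{0..1}. f x = y" if "y \<in> {0..1}" for y
    using IVT'[of f 0 y 1] that ends cont by auto
  ultimately have im: "f ` {0..1} = {0..1}" by force
  obtain g where "homeomorphism {0..1} {0..1} f g"
    using homeomorphism_compact[OF _ cont im strict_mono_on_imp_inj_on[OF m]] by auto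
  then have "homeomorphism {0..1} {0..1} (restrict f {0..1}) g"
    by (rule homeomorphism_cong) auto
  moreover have "strict_mono_on {0..1} (restrict f {0..1})"
    using mono by (auto simp: strict_mono_on_def)
  ultimately show ?thesis by (auto simp: inc_homeo_def)
qed

lemma mult_H_plus_apply:
  assumes "f \<in> inc_homeo" "g \<in> inc_homeo" "x \<in> {0..1}"
  shows "(f \<otimes>\<^bsub>H_plus\<^esub> g) x = f (g x)"
  using assms by (simp add: mult_H_plus compose_eq)

lemma mult_inc_homeo [simp]:
  "f \<in> inc_homeo \<Longrightarrow> g \<in> inc_homeo \<Longrightarrow> f \<otimes>\<^bsub>H_plus\<^esub> g \<in> inc_homeo"
  using HP.m_closed by simp

lemma inv_inc_homeo [simp]: "f \<in> inc_homeo \<Longrightarrow> inv\<^bsub>H_plus\<^esub> f \<in> inc_homeo"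
  using HP.inv_closed by simp

lemma one_inc_homeo [simp]: "\<one>\<^bsub>H_plus\<^esub> \<in> inc_homeo"
  using HP.one_closed by simp

lemma inv_H_plus_apply:
  assumes "f \<in> inc_homeo" "x \<in> {0..1}"
  shows "f ((inv\<^bsub>H_plus\<^esub> f) x) = x" "(inv\<^bsub>H_plus\<^esub> f) (f x) = x"
  using assms mult_H_plus_apply[of f "inv\<^bsub>H_plus\<^esub> f" x] mult_H_plus_apply[of "inv\<^bsub>H_plus\<^esub> f" f x]
  by (auto simp: one_H_plus_apply HP.r_inv HP.l_inv)

lemma inc_homeo_mspace:
  assumes "f \<in> inc_homeo"
  shows "f \<in> mspace (cfunspace (top_of_set {0..1}) euclidean_metric)"
  using topspace_H_plus_top assms by (auto simp: H_plus_top_def)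

lemma topspace_H_plus_top_inc_homeo [simp]: "topspace H_plus_top = inc_homeo"
  by (simp add: topspace_H_plus_top)

text \<open>
  The next two lemmas translate between the supremum metric and uniform estimates of values, the
  form in which every later estimate is obtained.
\<close>
lemma H_plus_top_uniform_nhd:
  assumes f: "f \<in> inc_homeo" and "e > 0"
  obtains U where "openin H_plus_top U" "f \<in> U"
    "\<And>g x. g \<in> U \<Longrightarrow> x \<in> {0..1} \<Longrightarrow> \<bar>g x - f x\<bar> < e"
proof -
  let ?m = "cfunspace (top_of_set {0..1::real}) (euclidean_metric :: real metric)"
  interpret M: Metric_space "mspace ?m" "mdist ?m" by (rule Metric_space_mspace_mdist)
  define U where "U = inc_homeo \<inter> M.mball f e"
  have "openin H_plus_top U"
    unfolding U_def H_plus_top_def openin_subtopology mtopology_of_def by blast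
  moreover have "f \<in> U" using f inc_homeo_mspace \<open>e > 0\<close> by (auto simp: U_def simp del: mspace_cfunspace)
  moreover have "\<bar>g x - f x\<bar> < e" if "g \<in> U" "x \<in> {0..1}" for g x
  proof -
    have g: "g \<in> mspace ?m" "mdist ?m f g < e"
      using that by (auto simp: U_def simp del: mspace_cfunspace)
    have "mdist euclidean_metric (f x) (g x) < e"
      by (rule cfunspace_mdist_lt[OF _ inc_homeo_mspace[OF f] g]) (use that in auto)
    then show ?thesis by (simp add: dist_real_def abs_minus_commute)
  qed
  ultimately show thesis by (rule that)
qed

lemma continuous_map_H_plus_topI:
  assumes im: "\<And>x. x \<in> topspace Y \<Longrightarrow> F x \<in> inc_homeo"
    and nhd: "\<And>x e. x \<in> topspace Y \<Longrightarrow> e > 0 \<Longrightarrow>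
      \<exists>U. openin Y U \<and> x \<in> U \<and> (\<forall>y\<in>U. \<forall>z\<in>{0..1}. \<bar>F y z - F x z\<bar> \<le> e)"
  shows "continuous_map Y H_plus_top F"
proof -
  let ?m = "cfunspace (top_of_set {0..1::real}) (euclidean_metric :: real metric)"
  interpret M: Metric_space "mspace ?m" "mdist ?m" by (rule Metric_space_mspace_mdist)
  have "continuous_map Y M.mtopology F"
    unfolding M.continuous_map_to_metric
  proof (intro ballI allI impI)
    fix x e assume x: "x \<in> topspace Y" and e: "(e::real) > 0"
    obtain U where U: "openin Y U" "x \<in> U" "\<forall>y\<in>U. \<forall>z\<in>{0..1}. \<bar>F y z - F x z\<bar> \<le> e/2"
      using nhd[OF x, of "e/2"] e by auto
    have "F y \<in> M.mball (F x) e" if "y \<in> U" for y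
    proof -
      have y: "y \<in> topspace Y" using U(1) that openin_subset by blast
      have "mdist ?m (F x) (F y) \<le> e/2"
        by (rule mdist_cfunspace_le) (use e U that in \<open>auto simp: dist_real_def abs_minus_commute\<close>)
      then show ?thesis
        using e inc_homeo_mspace im x y by (auto simp del: mspace_cfunspace)
    qed
    then show "\<exists>U. openin Y U \<and> x \<in> U \<and> (\<forall>y\<in>U. F y \<in> M.mball (F x) e)" using U by blast
  qed
  then show ?thesis
    using im by (auto simp: H_plus_top_def continuous_map_in_subtopology mtopology_of_def)
qed

text \<open>
  The easy half of the Arzela--Ascoli theorem. Each element of a compact set is uniformly
  continuous, and finitely many of them are uniformly \<open>e/3\<close>-close to all the others.
\<close>
lemma compactin_H_plus_top_equicontinuous:
  assumes C: "compactin H_plus_top C" and "e > 0"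
  obtains d where "d > 0"
    "\<And>f x y. f \<in> C \<Longrightarrow> x \<in> {0..1} \<Longrightarrow> y \<in> {0..1} \<Longrightarrow> \<bar>x - y\<bar> \<le> d \<Longrightarrow> \<bar>f x - f y\<bar> \<le> e"
proof -
  have sub: "C \<subseteq> inc_homeo" using compactin_subset_topspace[OF C] by simp
  have "\<exists>U. openin H_plus_top U \<and> f \<in> U \<and> (\<forall>g\<in>U. \<forall>x\<in>{0..1}. \<bar>g x - f x\<bar> < e/3)"
    if "f \<in> C" for f
  proof -
    have "f \<in> inc_homeo" "e/3 > 0" using that sub \<open>e > 0\<close> by auto
    then show ?thesis by (rule H_plus_top_uniform_nhd) blast
  qed
  then obtain U where U: "\<And>f. f \<in> C \<Longrightarrow> openin H_plus_top (U f)" "\<And>f. f \<in> C \<Longrightarrow> f \<in> U f"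
    "\<And>f g x. f \<in> C \<Longrightarrow> g \<in> U f \<Longrightarrow> x \<in> {0..1} \<Longrightarrow> \<bar>g x - f x\<bar> < e/3"
    by metis
  obtain F where F: "finite F" "F \<subseteq> U ` C" "C \<subseteq> \<Union>F"
  proof -
    have "C \<subseteq> \<Union>(U ` C)" "\<forall>V\<in>U ` C. openin H_plus_top V" using U(1,2) by auto
    with C show thesis unfolding compactin_def by (metis that)
  qed
  obtain K where K: "finite K" "K \<subseteq> C" "F = U ` K"
    using finite_subset_image[OF F(1,2)] by blast
  have "\<exists>d>0. \<forall>x\<in>{0..1}. \<forall>y\<in>{0..1}. \<bar>x - y\<bar> \<le> d \<longrightarrow> \<bar>f x - f y\<bar> \<le> e/3" if "f \<in> K" for f
  proof -
    have "uniformly_continuous_on {0..1} f"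
      using that K sub by (intro compact_uniformly_continuous inc_homeo_continuous) auto
    then obtain d where "d > 0" "\<forall>x\<in>{0..1}. \<forall>y\<in>{0..1}. dist y x < d \<longrightarrow> dist (f y) (f x) < e/3"
      unfolding uniformly_continuous_on_def using \<open>e > 0\<close> by (metis divide_pos_pos zero_less_numeral)
    then show ?thesis
      by (intro exI[of _ "d/2"]) (force simp: dist_real_def abs_minus_commute intro: less_imp_le)
  qed
  then obtain d where d: "\<And>f. f \<in> K \<Longrightarrow> d f > 0"
    "\<And>f x y. f \<in> K \<Longrightarrow> x \<in> {0..1} \<Longrightarrow> y \<in> {0..1} \<Longrightarrow> \<bar>x - y\<bar> \<le> d f \<Longrightarrow> \<bar>f x - f y\<bar> \<le> e/3"
    by metis
  define D where "D = Min (insert 1 (d ` K))"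
  have "D > 0" using d(1) K(1) by (auto simp: D_def)
  moreover have "\<bar>g x - g y\<bar> \<le> e"
    if g: "g \<in> C" and that: "x \<in> {0..1}" "y \<in> {0..1}" "\<bar>x - y\<bar> \<le> D" for g x y
  proof -
    obtain f where f: "f \<in> K" "g \<in> U f" using F(3) K(3) g by auto
    have "D \<le> d f" using f(1) K(1) by (auto simp: D_def)
    then have "\<bar>f x - f y\<bar> \<le> e/3" using d(2)[OF f(1)] that by auto
    moreover have "\<bar>g x - f x\<bar> < e/3" "\<bar>g y - f y\<bar> < e/3" using U(3) f K(2) that by blast+
    ultimately show ?thesis by linarith
  qed
  ultimately show thesis by (rule that)
qed

text \<open>
  \<open>\<bar>h (k z) - f (g z)\<bar>\<close> splits into the distance of \<open>h\<close> and \<open>f\<close> and a term that the uniform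
  continuity of \<open>f\<close> controls.
\<close>
lemma continuous_map_mult_H_plus:
  "continuous_map (prod_topology H_plus_top H_plus_top) H_plus_top (\<lambda>(f, g). f \<otimes>\<^bsub>H_plus\<^esub> g)"
proof (rule continuous_map_H_plus_topI, goal_cases)
  case (1 x) then show ?case by auto
next
  case (2 x e)
  obtain f g where x: "x = (f, g)" "f \<in> inc_homeo" "g \<in> inc_homeo" using 2 by auto
  obtain d where d: "d > 0" "\<And>x y. x \<in> {0..1} \<Longrightarrow> y \<in> {0..1} \<Longrightarrow> \<bar>x - y\<bar> \<le> d \<Longrightarrow> \<bar>f x - f y\<bar> \<le> e/2"
  proof -
    have "compactin H_plus_top {f}" using x by simp
    from compactin_H_plus_top_equicontinuous[OF this, of "e/2"] show thesis
      using that 2(2) by (metis half_gt_zero singletonI)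
  qed
  obtain U where U: "openin H_plus_top U" "f \<in> U" "\<And>h x. h \<in> U \<Longrightarrow> x \<in> {0..1} \<Longrightarrow> \<bar>h x - f x\<bar> < e/2"
    using H_plus_top_uniform_nhd[OF x(2), of "e/2"] 2(2) by auto
  obtain V where V: "openin H_plus_top V" "g \<in> V" "\<And>h x. h \<in> V \<Longrightarrow> x \<in> {0..1} \<Longrightarrow> \<bar>h x - g x\<bar> < d"
    using H_plus_top_uniform_nhd[OF x(3) d(1)] by auto
  have "\<bar>(h \<otimes>\<^bsub>H_plus\<^esub> k) z - (f \<otimes>\<^bsub>H_plus\<^esub> g) z\<bar> \<le> e" if "h \<in> U" "k \<in> V" "z \<in> {0..1}" for h k z
  proof -
    have hk: "h \<in> inc_homeo" "k \<in> inc_homeo" using that U(1) V(1) openin_subset by fastforce+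
    have kz: "k z \<in> {0..1}" "g z \<in> {0..1}" using hk x that by (auto simp: inc_homeo_in simp del: atLeastAtMost_iff)
    have "\<bar>h (k z) - f (k z)\<bar> < e/2" using U(3) that kz by blast
    moreover have "\<bar>f (k z) - f (g z)\<bar> \<le> e/2" using d(2) kz V(3)[of k z] that by force
    ultimately have "\<bar>h (k z) - f (g z)\<bar> \<le> e" by linarith
    then show ?thesis using hk x that by (simp add: mult_H_plus_apply)
  qed
  moreover have "openin (prod_topology H_plus_top H_plus_top) (U \<times> V)" using U V by (simp add: openin_prod_Times_iff)
  ultimately show ?case using x U(2) V(2) by (intro exI[of _ "U \<times> V"]) auto
qed

section \<open>Supports\<close>
definition supported_on :: "(real \<Rightarrow> real) \<Rightarrow> real \<Rightarrow> real \<Rightarrow> bool"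
  where "supported_on f p r \<longleftrightarrow> (\<forall>x\<in>{0..1}. x \<notin> {p<..<r} \<longrightarrow> f x = x)"

lemma supported_on_maps_into:
  assumes f: "f \<in> inc_homeo" "supported_on f p r" and pr: "p \<in> {0..1}" "r \<in> {0..1}"
    and x: "x \<in> {p<..<r}"
  shows "f x \<in> {p<..<r}"
proof -
  have "f p = p" "f r = r" using f pr by (auto simp: supported_on_def)
  then show ?thesis using inc_homeo_less_iff[OF f(1), of p x] inc_homeo_less_iff[OF f(1), of x r] pr x
    by auto
qed

lemma supported_on_conj:
  assumes u: "u \<in> inc_homeo" and f: "f \<in> inc_homeo" "supported_on f p r"
    and pr: "p \<in> {0..1}" "r \<in> {0..1}"
  shows "supported_on (u \<otimes>\<^bsub>H_plus\<^esub> f \<otimes>\<^bsub>H_plus\<^esub> inv\<^bsub>H_plus\<^esub> u) (u p) (u r)"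
  unfolding supported_on_def
proof (intro ballI impI)
  fix x :: real assume x: "x \<in> {0..1}" "x \<notin> {u p<..<u r}"
  let ?y = "(inv\<^bsub>H_plus\<^esub> u) x"
  have y: "?y \<in> {0..1}" "u ?y = x" using u x by (simp_all add: inc_homeo_in inv_H_plus_apply del: atLeastAtMost_iff)
  have "?y \<notin> {p<..<r}" using x(2) y inc_homeo_less_iff[OF u] pr by (metis greaterThanLessThan_iff)
  then have "f ?y = ?y" using f y by (auto simp: supported_on_def)
  then show "(u \<otimes>\<^bsub>H_plus\<^esub> f \<otimes>\<^bsub>H_plus\<^esub> inv\<^bsub>H_plus\<^esub> u) x = x"
    using u f x y by (simp add: mult_H_plus_apply del: atLeastAtMost_iff)
qed

lemma supported_on_inv:
  assumes f: "f \<in> inc_homeo" "supported_on f p r"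
  shows "supported_on (inv\<^bsub>H_plus\<^esub> f) p r"
  using f inv_H_plus_apply(2)[OF f(1)] unfolding supported_on_def by metis

lemma conj_H_plus_apply:
  assumes "g \<in> inc_homeo" "f \<in> inc_homeo" "x \<in> {0..1}"
  shows "(g \<otimes>\<^bsub>H_plus\<^esub> f \<otimes>\<^bsub>H_plus\<^esub> inv\<^bsub>H_plus\<^esub> g) (g x) = g (f x)"
  using assms inc_homeo_in[OF assms(1,3)]
  by (simp add: mult_H_plus_apply inv_H_plus_apply del: atLeastAtMost_iff)

lemma disjoint_supports_commute:
  assumes f: "f \<in> inc_homeo" "supported_on f p r" and g: "g \<in> inc_homeo" "supported_on g p' r'"
    and le: "r \<le> p'" and pr: "p \<in> {0..1}" "r \<in> {0..1}" "p' \<in> {0..1}" "r' \<in> {0..1}"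
  shows "f \<otimes>\<^bsub>H_plus\<^esub> g = g \<otimes>\<^bsub>H_plus\<^esub> f"
proof (rule inc_homeo_eqI)
  fix x :: real assume x: "x \<in> {0..1}"
  have "f (g x) = g (f x)"
  proof (cases "x \<in> {p<..<r}")
    case True
    then have "g x = x" "g (f x) = f x"
      using g f x le supported_on_maps_into[OF f pr(1,2) True] pr by (auto simp: supported_on_def)
    then show ?thesis by simp
  next
    case False
    have "g x \<notin> {p<..<r}"
    proof (cases "x \<in> {p'<..<r'}")
      case True
      then show ?thesis using supported_on_maps_into[OF g pr(3,4) True] le by auto
    next
      case F: False
      then have "g x = x" using g x unfolding supported_on_def by blast
      then show ?thesis using False by simp
    qed
    then have "f (g x) = g x" "f x = x"
      using f x False inc_homeo_in[OF g(1) x] unfolding supported_on_def by blast+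
    then show ?thesis by simp
  qed
  then show "(f \<otimes>\<^bsub>H_plus\<^esub> g) x = (g \<otimes>\<^bsub>H_plus\<^esub> f) x"
    using f g x by (simp add: mult_H_plus_apply)
qed (use f g in auto)

section \<open>Steep homeomorphisms\<close>

text \<open>
  Given points \<open>x k\<close> to the right of \<open>p\<close>, which may approach \<open>p\<close> at any rate, there is a homeomorphism
  whose displacement at \<open>x k\<close> is bounded below by a fixed sequence; so no modulus of continuity
  given in advance controls it at \<open>p\<close>. It is half the identity plus a weighted sum of ramps, the \<open>k\<close>-th of
  which has risen from \<open>0\<close> to its full height \<open>1 / 2 ^ (k + 2)\<close> when it reaches \<open>x k\<close>. The heights sum to \<open>1/2\<close>,
  so that the two halves add up to the identity at \<open>r\<close>.
\<close>
lemma ex_steep_inc_homeo: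
  assumes pr: "0 \<le> p" "p < r" "r \<le> 1" and x: "\<And>k::nat. p < x k" 
  obtains g where "g \<in> inc_homeo" "supported_on g p r"
    "\<And>k. x k \<le> 1 \<Longrightarrow> g (x k) \<ge> p + (r - p) / 2 ^ (k + 2)"
proof -
  define s where "s k z = (1/2)^(k+2) * max 0 (min 1 ((z - p) / (min (x k) r - p)))" for k and z :: real
  define S where "S z = suminf (\<lambda>k. s k z)" for z
  define G where "G z = z - max 0 (min (z - p) (r - p)) / 2 + (r - p) * S z" for z
  have y: "min (x k) r - p > 0" for k using x pr by auto
  then have y0: "p \<noteq> min (x k) r" for k by (metis diff_self less_irrefl)
  have s_nonneg: "s k z \<ge> 0" for k z by (simp add: s_def)
  have "s k z \<le> (1/2)^(k+2) * 1" for k z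
    unfolding s_def by (rule mult_left_mono) auto
  then have s_le: "s k z \<le> (1/2)^(k+2)" for k z by simp
  have half: "(\<lambda>k. (1/2::real)^(k+2)) sums (1/2)"
  proof -
    have "(\<lambda>k. (1/4) * (1/2::real)^k) sums ((1/4) * (1 / (1 - 1/2)))"
      by (intro sums_mult geometric_sums) auto
    then show ?thesis by (simp add: power_add power2_eq_square mult.commute)
  qed
  have summ: "summable (\<lambda>k. s k z)" for z
    by (rule summable_comparison_test'[OF sums_summable[OF half], of 0]) (use s_le s_nonneg in auto)
  have s_mono: "s k z \<le> s k z'" if "z \<le> z'" for k z z'
    unfolding s_def using that y[of k] by (intro mult_left_mono max.mono min.mono divide_right_mono) auto
  have S_mono: "S z \<le> S z'" if "z \<le> z'" for z z'
    unfolding S_def by (intro suminf_le s_mono that summ)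
  have S_0: "S z = 0" if "z \<le> p" for z
  proof -
    have "s k z = 0" for k
      using that y[of k] divide_nonpos_pos[of "z - p" "min (x k) r - p"] by (simp add: s_def)
    then show ?thesis by (simp add: S_def)
  qed
  have S_1: "S z = 1/2" if "z \<ge> r" for z
  proof -
    have "s k z = (1/2)^(k+2)" for k
    proof -
      have "1 \<le> (z - p) / (min (x k) r - p)" using that y[of k] by (simp add: le_divide_eq)
      then show ?thesis by (simp add: s_def min_def)
    qed
    then have "(\<lambda>k. s k z) = (\<lambda>k. (1/2)^(k+2))" by auto
    then show ?thesis using sums_unique[OF half] by (metis S_def)
  qed
  have "uniform_limit UNIV (\<lambda>n z. \<Sum>k<n. s k z) S sequentially"
    unfolding S_def by (rule Weierstrass_m_test[OF _ sums_summable[OF half]]) (use s_le s_nonneg in auto)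
  then have S_cont: "continuous_on UNIV S"
    by (rule uniform_limit_theorem[rotated])
       (auto simp: s_def y0 intro!: always_eventually continuous_intros)
  have G_out: "G z = z" if "z \<le> p \<or> r \<le> z" for z
    using that pr by (auto simp: G_def S_0 S_1 field_simps)
  have G_mono: "G z < G z'" if "z < z'" for z z'
  proof -
    have "z - max 0 (min (z - p) (r - p)) / 2 < z' - max 0 (min (z' - p) (r - p)) / 2"
      using that by (auto simp: max_def min_def field_simps)
    moreover have "(r - p) * S z \<le> (r - p) * S z'" using S_mono that pr by (intro mult_left_mono) auto
    ultimately show ?thesis by (simp add: G_def)
  qed
  have "continuous_on {0..1} G"
    unfolding G_def by (intro continuous_intros continuous_on_subset[OF S_cont]) auto
  then have "restrict G {0..1} \<in> inc_homeo"
    using G_out[of 0] G_out[of 1] pr by (intro inc_homeoI G_mono) auto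
  moreover have "supported_on (restrict G {0..1}) p r"
    using G_out by (auto simp: supported_on_def)
  moreover have "restrict G {0..1} (x k) \<ge> p + (r - p) / 2 ^ (k + 2)" if "x k \<le> 1" for k
  proof -
    have "1 \<le> (x k - p) / (min (x k) r - p)" using y[of k] by (simp add: le_divide_eq)
    then have "s k (x k) = (1/2)^(k+2)" by (simp add: s_def min_def)
    moreover have "s k (x k) \<le> S (x k)"
      unfolding S_def using sum_le_suminf[OF summ[of "x k"], of "{k}"] s_nonneg by simp
    ultimately have "(r - p) * (1/2)^(k+2) \<le> (r - p) * S (x k)" using pr by (intro mult_left_mono) auto
    moreover have "x k - max 0 (min (x k - p) (r - p)) / 2 \<ge> p"
      using x[of k] by (simp add: max_def min_def field_simps)
    ultimately have "G (x k) \<ge> p + (r - p) * (1/2)^(k+2)" unfolding G_def by linarith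
    moreover have "(r - p) * (1/2)^(k+2) = (r - p) / 2^(k+2)" by (simp only: power_one_over) simp
    moreover have "restrict G {0..1} (x k) = G (x k)" using that x[of k] pr by simp
    ultimately show ?thesis by linarith
  qed
  ultimately show thesis by (rule that)
qed

section \<open>A one-parameter group\<close>

text \<open>
  Any one-parameter group without fixed points in \<open>(0,1)\<close> would do; powers make the group law and
  the monotonicity in the time immediate. The sign is such that points move to the right as
  \<open>t\<close> grows.
\<close>
definition flow :: "real \<Rightarrow> real \<Rightarrow> real"
  where "flow t = (\<lambda>x\<in>{0..1}. x powr exp (- t))"

lemma flow_apply: "x \<in> {0..1} \<Longrightarrow> flow t x = x powr exp (- t)"
  by (simp add: flow_def)

lemma continuous_on_flow_joint: "continuous_on (UNIV \<times> {0..1}) (\<lambda>(t, x). x powr exp (- t :: real))"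
  unfolding case_prod_unfold by (intro continuous_on_powr' continuous_intros) auto

lemma flow_inc_homeo [simp]: "flow t \<in> inc_homeo"
  unfolding flow_def
proof (rule inc_homeoI)
  show "continuous_on {0..1} (\<lambda>x. x powr exp (- t))"
    by (intro continuous_on_powr' continuous_intros) auto
qed (auto intro: powr_less_mono2)

lemma flow_add: "flow s \<otimes>\<^bsub>H_plus\<^esub> flow t = flow (s + t)"
proof (rule inc_homeo_eqI)
  fix x :: real assume x: "x \<in> {0..1}"
  have "flow t x \<in> {0..1}" using x by (rule inc_homeo_in[OF flow_inc_homeo])
  then have "flow s (flow t x) = (x powr exp (-t)) powr exp (-s)"
    using flow_apply[of "flow t x" s] flow_apply[OF x] by simp
  also have "\<dots> = flow (s + t) x" 
    using x by (simp add: flow_apply powr_powr exp_add[symmetric] algebra_simps)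
  finally show "(flow s \<otimes>\<^bsub>H_plus\<^esub> flow t) x = flow (s + t) x"
    using x by (simp add: mult_H_plus_apply)
qed auto

lemma flow_0: "flow 0 = \<one>\<^bsub>H_plus\<^esub>"
  by (rule inc_homeo_eqI) (auto simp: flow_apply one_H_plus_apply)

lemma inv_flow: "inv\<^bsub>H_plus\<^esub> flow t = flow (- t)"
  by (rule HP.inv_equality) (auto simp: flow_add flow_0)

lemma flow_mono: "x \<in> {0..1} \<Longrightarrow> s \<le> t \<Longrightarrow> flow s x \<le> flow t x"
  by (auto simp: flow_apply intro: powr_mono')

lemma flow_strict_mono: "0 < x \<Longrightarrow> x < 1 \<Longrightarrow> s < t \<Longrightarrow> flow s x < flow t x"
  by (auto simp: flow_apply intro: powr_less_mono')

lemma continuous_map_flow: "continuous_map euclideanreal H_plus_top flow"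
proof (rule continuous_map_H_plus_topI)
  fix t e :: real assume "e > 0"
  have "uniformly_continuous_on ({t-1..t+1} \<times> {0..1}) (\<lambda>(t, x). x powr exp (- t :: real))"
    by (intro compact_uniformly_continuous continuous_on_subset[OF continuous_on_flow_joint] compact_Times) auto
  then obtain d where d: "d > 0"
    "\<And>p q. p \<in> {t-1..t+1} \<times> {0..1} \<Longrightarrow> q \<in> {t-1..t+1} \<times> {0..1} \<Longrightarrow> dist q p < d \<Longrightarrow>
      dist ((\<lambda>(t, x). x powr exp (- t :: real)) q) ((\<lambda>(t, x). x powr exp (- t)) p) < e"
    unfolding uniformly_continuous_on_def using \<open>e > 0\<close> by metis
  have "\<bar>flow s z - flow t z\<bar> \<le> e" if "s \<in> ball t (min 1 d)" "z \<in> {0..1}" for s z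
  proof -
    have "s \<in> {t-1..t+1}" "\<bar>s - t\<bar> < d" using that(1) by (auto simp: dist_real_def)
    then show ?thesis
      using d(2)[of "(t, z)" "(s, z)"] that(2) by (auto simp: flow_apply dist_Pair_Pair dist_real_def)
  qed
  then show "\<exists>U. openin euclideanreal U \<and> t \<in> U \<and> (\<forall>s\<in>U. \<forall>z\<in>{0..1}. \<bar>flow s z - flow t z\<bar> \<le> e)"
    using d(1) by (intro exI[of _ "ball t (min 1 d)"]) auto
qed auto

text \<open>
  Steps of the form \<open>1 / w\<close> with \<open>w\<close> a natural number let \<open>w\<close> steps cover one unit of time exactly.
\<close>
lemma ex_flow_small_step:
  assumes "1/2 < y"
  obtains w :: nat where "(0::nat) < w" "flow (1 / w) (1/2) \<le> y"
proof -
  have "(\<lambda>w::nat. (1/2) powr exp (- (1 / w))) \<longlonglongrightarrow> (1/2::real) powr exp (- 0)"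
    by (intro tendsto_intros lim_1_over_n) auto
  then have "\<forall>\<^sub>F w::nat in sequentially. (1/2) powr exp (- (1 / w)) < y"
    using assms by (intro order_tendstoD) auto
  then have "\<forall>\<^sub>F w::nat in sequentially. (1/2) powr exp (- (1 / w)) < y \<and> (0::nat) < w"
    by (rule eventually_conj[OF _ eventually_gt_at_top])
  then obtain w :: nat where "(1/2) powr exp (- (1 / w)) < y" "(0::nat) < w" 
    using eventually_happens by force
  then show thesis by (intro that[of w]) (auto simp: flow_apply)
qed

section \<open>Displacement estimates\<close>
abbreviation moved_at_most :: "(real \<Rightarrow> real) \<Rightarrow> real \<Rightarrow> bool"
  where "moved_at_most f e \<equiv> (\<forall>x\<in>{0..1}. \<bar>f x - x\<bar> \<le> e)"

lemma moved_at_most_conj: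
  assumes "g \<in> inc_homeo" "h \<in> inc_homeo" and h: "moved_at_most h d"
    and g: "\<And>x y. x \<in> {0..1} \<Longrightarrow> y \<in> {0..1} \<Longrightarrow> \<bar>x - y\<bar> \<le> d \<Longrightarrow> \<bar>g x - g y\<bar> \<le> e"
  shows "moved_at_most (g \<otimes>\<^bsub>H_plus\<^esub> h \<otimes>\<^bsub>H_plus\<^esub> inv\<^bsub>H_plus\<^esub> g) e"
proof
  fix x :: real assume x: "x \<in> {0..1}"
  define y where "y = (inv\<^bsub>H_plus\<^esub> g) x"
  have y: "y \<in> {0..1}" "g y = x"
    using assms(1) x by (simp_all add: y_def inc_homeo_in inv_H_plus_apply del: atLeastAtMost_iff)
  have "\<bar>g (h y) - g y\<bar> \<le> e" using g[of "h y" y] inc_homeo_in[OF assms(2) y(1)] y(1) h by blast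
  then show "\<bar>(g \<otimes>\<^bsub>H_plus\<^esub> h \<otimes>\<^bsub>H_plus\<^esub> inv\<^bsub>H_plus\<^esub> g) x - x\<bar> \<le> e"
    using assms(1,2) x y by (simp add: mult_H_plus_apply y_def[symmetric] del: atLeastAtMost_iff)
qed

lemma moved_at_most_inv:
  assumes "h \<in> inc_homeo" "moved_at_most h e"
  shows "moved_at_most (inv\<^bsub>H_plus\<^esub> h) e"
  using assms inv_H_plus_apply(1)[OF assms(1)] inc_homeo_in[OF inv_inc_homeo[OF assms(1)]]
  by (metis abs_minus_commute)

text \<open>
  Conjugation by a map close to the identity changes \<open>g\<close> little, so the commutation passes to the
  limit. As the uniform bound is inherited by inverses, the limit can be taken pointwise.
\<close>
lemma commute_of_commute_with_conj:
  assumes f: "f \<in> inc_homeo" and g: "g \<in> inc_homeo"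
    and ex: "\<And>d. d > 0 \<Longrightarrow> \<exists>u\<in>inc_homeo. moved_at_most u d \<and>
      f \<otimes>\<^bsub>H_plus\<^esub> (u \<otimes>\<^bsub>H_plus\<^esub> g \<otimes>\<^bsub>H_plus\<^esub> inv\<^bsub>H_plus\<^esub> u) =
      (u \<otimes>\<^bsub>H_plus\<^esub> g \<otimes>\<^bsub>H_plus\<^esub> inv\<^bsub>H_plus\<^esub> u) \<otimes>\<^bsub>H_plus\<^esub> f"
  shows "f \<otimes>\<^bsub>H_plus\<^esub> g = g \<otimes>\<^bsub>H_plus\<^esub> f"
proof (rule inc_homeo_eqI)
  fix x :: real assume x: "x \<in> {0..1}"
  have "\<forall>n. \<exists>u\<in>inc_homeo. moved_at_most u (1 / real (Suc n)) \<and>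
      f \<otimes>\<^bsub>H_plus\<^esub> (u \<otimes>\<^bsub>H_plus\<^esub> g \<otimes>\<^bsub>H_plus\<^esub> inv\<^bsub>H_plus\<^esub> u) =
      (u \<otimes>\<^bsub>H_plus\<^esub> g \<otimes>\<^bsub>H_plus\<^esub> inv\<^bsub>H_plus\<^esub> u) \<otimes>\<^bsub>H_plus\<^esub> f"
    using ex by simp
  then obtain u where u: "\<And>n. u n \<in> inc_homeo" "\<And>n. moved_at_most (u n) (1 / real (Suc n))"
    and comm: "\<And>n. f \<otimes>\<^bsub>H_plus\<^esub> (u n \<otimes>\<^bsub>H_plus\<^esub> g \<otimes>\<^bsub>H_plus\<^esub> inv\<^bsub>H_plus\<^esub> u n) =
      (u n \<otimes>\<^bsub>H_plus\<^esub> g \<otimes>\<^bsub>H_plus\<^esub> inv\<^bsub>H_plus\<^esub> u n) \<otimes>\<^bsub>H_plus\<^esub> f"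
    by metis
  define v where "v n = inv\<^bsub>H_plus\<^esub> u n" for n
  have v: "v n \<in> inc_homeo" "moved_at_most (v n) (1 / real (Suc n))" for n
    using u moved_at_most_inv[OF u] by (auto simp: v_def)
  have close: "(\<lambda>n. h n (z n)) \<longlonglongrightarrow> l"
    if "\<And>n. z n \<in> {0..1}" "z \<longlonglongrightarrow> l" "\<And>n. moved_at_most (h n) (1 / real (Suc n))"
    for h :: "nat \<Rightarrow> real \<Rightarrow> real" and z l
  proof -
    have "(\<lambda>n. h n (z n) - z n) \<longlonglongrightarrow> 0"
      by (rule Lim_null_comparison[OF _ lim_1_over_n[THEN LIMSEQ_Suc]])
         (use that in \<open>auto intro!: always_eventually simp del: of_nat_Suc atLeastAtMost_iff\<close>)
    from tendsto_add[OF this that(2)] show ?thesis by simp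
  qed
  have cont: "(\<lambda>n. h (z n)) \<longlonglongrightarrow> h l"
    if "h \<in> inc_homeo" "\<And>n. z n \<in> {0..1}" "z \<longlonglongrightarrow> l" "l \<in> {0..1}" for h z l
    using continuous_on_tendsto_compose[OF inc_homeo_continuous[OF that(1)] that(3,4)] that(2) by simp
  note into = inc_homeo_in[OF f] inc_homeo_in[OF g] inc_homeo_in[OF u(1)] inc_homeo_in[OF v(1)] x
  have A: "(\<lambda>n. u n (g (v n z))) \<longlonglongrightarrow> g z" if "z \<in> {0..1}" for z
    using that by (intro close[OF _ _ u(2)] cont[OF g] close[OF _ _ v(2)] into tendsto_const)
  have "f (u n (g (v n x))) = u n (g (v n (f x)))" for n
  proof -
    have "(f \<otimes>\<^bsub>H_plus\<^esub> (u n \<otimes>\<^bsub>H_plus\<^esub> g \<otimes>\<^bsub>H_plus\<^esub> v n)) x =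
      ((u n \<otimes>\<^bsub>H_plus\<^esub> g \<otimes>\<^bsub>H_plus\<^esub> v n) \<otimes>\<^bsub>H_plus\<^esub> f) x"
      using comm[of n] by (simp add: v_def)
    then show ?thesis using f g u(1) v(1) into by (simp add: mult_H_plus_apply del: atLeastAtMost_iff)
  qed
  moreover have "(\<lambda>n. f (u n (g (v n x)))) \<longlonglongrightarrow> f (g x)"
    by (intro cont[OF f] A into)
  moreover have "(\<lambda>n. u n (g (v n (f x)))) \<longlonglongrightarrow> g (f x)"
    by (intro A into)
  ultimately have "f (g x) = g (f x)" using LIMSEQ_unique by simp
  then show "(f \<otimes>\<^bsub>H_plus\<^esub> g) x = (g \<otimes>\<^bsub>H_plus\<^esub> f) x"
    using f g x by (simp add: mult_H_plus_apply)
qed (use f g in auto)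

lemma ex_short_step:
  fixes a :: "nat \<Rightarrow> real" and M :: nat
  assumes a: "\<And>j. a j \<in> {0..1}" and mono: "incseq a \<or> decseq a" and M: "M > 0"
  obtains j where "j < M" "\<bar>a (Suc j) - a j\<bar> \<le> 1 / M"
proof -
  have eq: "(\<Sum>j<M. \<bar>a (Suc j) - a j\<bar>) = \<bar>a M - a 0\<bar>"
  proof (cases "incseq a")
    case True
    then have "\<bar>a (Suc j) - a j\<bar> = a (Suc j) - a j" for j by (simp add: incseq_SucD)
    moreover have "a 0 \<le> a M" using True by (simp add: incseqD)
    ultimately show ?thesis by (simp add: sum_lessThan_telescope)
  next
    case False
    then have d: "decseq a" using mono by simp
    then have "\<bar>a (Suc j) - a j\<bar> = a j - a (Suc j)" for j by (simp add: decseq_SucD)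
    moreover have "a M \<le> a 0" using d by (simp add: decseqD)
    ultimately show ?thesis by (simp add: sum_lessThan_telescope')
  qed
  have "\<exists>j<M. \<bar>a (Suc j) - a j\<bar> \<le> 1 / M"
  proof (rule ccontr)
    assume "\<not> ?thesis"
    then have "(\<Sum>j<M. 1 / real M) < (\<Sum>j<M. \<bar>a (Suc j) - a j\<bar>)"
      using M by (intro sum_strict_mono) (auto simp: not_le)
    then have "1 < \<bar>a M - a 0\<bar>" using eq M by simp
    then show False using a[of 0] a[of M] by auto
  qed
  then show thesis using that by blast
qed

text \<open>
  Follow the orbit of \<open>x\<close> under \<open>\<theta> d\<close>, started at time \<open>t0\<close>. It is monotone, so among \<open>M\<close> consecutive
  steps one has length at most \<open>1 / M\<close>; going back in time by \<open>\<theta> (- t)\<close> turns this step into the one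
  from \<open>x\<close> to \<open>\<theta> d x\<close>. Hence equicontinuity is assumed for the maps going back, during the time interval in
  which the \<open>M\<close> steps are made.
\<close>
lemma moved_at_most_one_parameter:
  fixes \<theta> :: "real \<Rightarrow> real \<Rightarrow> real" and M :: nat and t0 d e :: real
  assumes \<theta>: "\<And>t. \<theta> t \<in> inc_homeo" "\<And>s t. \<theta> (s + t) = \<theta> s \<otimes>\<^bsub>H_plus\<^esub> \<theta> t" "\<theta> 0 = \<one>\<^bsub>H_plus\<^esub>"
    and M: "M > 0" and d: "d \<ge> 0"
    and equi: "\<And>t x y. t \<in> {t0..t0 + M * d} \<Longrightarrow> x \<in> {0..1} \<Longrightarrow> y \<in> {0..1} \<Longrightarrow> \<bar>x - y\<bar> \<le> 1 / M \<Longrightarrow>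
      \<bar>\<theta> (- t) x - \<theta> (- t) y\<bar> \<le> e"
  shows "moved_at_most (\<theta> d) e"
proof
  fix x :: real assume x: "x \<in> {0..1}"
  have comp: "\<theta> (s + t) x = \<theta> s (\<theta> t x)" for s t
    using \<theta>(1,2) x by (simp add: mult_H_plus_apply)
  have into: "\<theta> t x \<in> {0..1}" for t by (rule inc_homeo_in[OF \<theta>(1) x])
  define a where "a j = \<theta> (t0 + j * d) x" for j :: nat
  have a_Suc: "a (Suc j) = \<theta> (t0 + j * d) (\<theta> d x)" for j
    by (simp add: a_def comp[symmetric] algebra_simps)
  have "incseq a \<or> decseq a"
  proof (cases "x \<le> \<theta> d x")
    case True
    then have "incseq a"
      unfolding incseq_Suc_iff a_Suc unfolding a_def
      by (simp only: inc_homeo_le_iff[OF \<theta>(1) x into]) simp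
    then show ?thesis by simp
  next
    case False
    then have "decseq a"
      unfolding decseq_Suc_iff a_Suc unfolding a_def
      by (simp only: inc_homeo_le_iff[OF \<theta>(1) into x]) simp
    then show ?thesis by simp
  qed
  then obtain j where j: "j < M" "\<bar>a (Suc j) - a j\<bar> \<le> 1 / M"
    using ex_short_step[of a M] into M by (auto simp: a_def)
  let ?t = "t0 + j * d"
  have t: "?t \<in> {t0..t0 + M * d}" using j(1) d by (auto intro: mult_right_mono)
  have "\<bar>\<theta> (- ?t) (a (Suc j)) - \<theta> (- ?t) (a j)\<bar> \<le> e"
    by (rule equi[OF t _ _ j(2)]) (simp_all only: a_def into)
  moreover have "\<theta> (- ?t) (a j) = x"
    using comp[of "- ?t" ?t] x \<theta>(3) by (simp add: a_def one_H_plus_apply)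
  moreover have "\<theta> (- ?t) (a (Suc j)) = \<theta> d x"
    using comp[of "- ?t" "?t + d"] by (simp add: a_def algebra_simps)
  ultimately show "\<bar>\<theta> d x - x\<bar> \<le> e" by simp
qed

section \<open>Sweeping an interval off itself\<close>

text \<open>
  The \<open>j\<close>-th factor is \<open>flow d\<close>, expanded by \<open>a\<close> near \<open>1/2\<close> and transported to the point
  \<open>flow (- c j) (1/2)\<close>. The factors act one after the other, each taking over the moved point
  where the previous one has left it.
\<close>
primrec sweep :: "(real \<Rightarrow> real) \<Rightarrow> real \<Rightarrow> (nat \<Rightarrow> real) \<Rightarrow> nat \<Rightarrow> real \<Rightarrow> real"
  where "sweep a d c 0 = \<one>\<^bsub>H_plus\<^esub>"
  | "sweep a d c (Suc j) =
      ((flow (- c j) \<otimes>\<^bsub>H_plus\<^esub> a) \<otimes>\<^bsub>H_plus\<^esub> flow d \<otimes>\<^bsub>H_plus\<^esub> inv\<^bsub>H_plus\<^esub> (flow (- c j) \<otimes>\<^bsub>H_plus\<^esub> a))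
      \<otimes>\<^bsub>H_plus\<^esub> sweep a d c j"

lemma sweep_inc_homeo [simp]: "a \<in> inc_homeo \<Longrightarrow> sweep a d c j \<in> inc_homeo"
  by (induction j) auto

text \<open>
  One factor maps \<open>flow (- c j) (1/2)\<close> to \<open>flow (- c j) (a (flow d (1/2)))\<close>, hence beyond
  \<open>flow (s - c j) (1/2)\<close>. So time \<open>s\<close> is gained in each step, no matter how small \<open>d\<close> is.
\<close>
lemma sweep_moves_far:
  assumes a: "a \<in> inc_homeo" "a (1/2) = 1/2" "flow s (1/2) \<le> a (flow d (1/2))"
    and c: "\<And>j. c j - s \<le> c (Suc j)"
  shows "flow (- c j) (1/2) \<le> sweep a d c j (flow (- c 0) (1/2))"
proof (induction j)
  case 0
  have "flow (- c 0) (1/2) \<in> {0..1}" by (rule inc_homeo_in) auto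
  then show ?case by (simp add: one_H_plus_apply del: atLeastAtMost_iff)
next
  case (Suc j)
  let ?g = "flow (- c j) \<otimes>\<^bsub>H_plus\<^esub> a"
  let ?f = "?g \<otimes>\<^bsub>H_plus\<^esub> flow d \<otimes>\<^bsub>H_plus\<^esub> inv\<^bsub>H_plus\<^esub> ?g"
  let ?y = "sweep a d c j (flow (- c 0) (1/2))"
  have h: "(1/2::real) \<in> {0..1}" by simp
  note I = inc_homeo_in[OF flow_inc_homeo] inc_homeo_in[OF a(1)] inc_homeo_in[OF sweep_inc_homeo[OF a(1)]]
  have fl: "flow t (flow t' x) = flow (t + t') x" if "x \<in> {0..1}" for t t' x
    using mult_H_plus_apply[of "flow t" "flow t'" x] that by (simp add: flow_add)
  have g: "?g (1/2) = flow (- c j) (1/2)" by (simp only: mult_H_plus_apply[OF flow_inc_homeo a(1) h] a(2))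
  have "flow (- c (Suc j)) (1/2) \<le> flow (- c j) (flow s (1/2))"
    using c[of j] by (auto simp: fl intro: flow_mono)
  also have "\<dots> \<le> flow (- c j) (a (flow d (1/2)))"
    using a(3) by (subst inc_homeo_le_iff[OF flow_inc_homeo I(1)[OF h] I(2)[OF I(1)[OF h]]])
  also have "\<dots> = ?f (?g (1/2))"
    using a(1) by (simp only: conj_H_plus_apply mult_inc_homeo flow_inc_homeo h
        mult_H_plus_apply[OF flow_inc_homeo a(1) I(1)[OF h]])
  also have "\<dots> \<le> ?f ?y"
    using Suc.IH a(1) by (subst inc_homeo_le_iff[OF _ _ I(3)[OF I(1)[OF h]]]) (simp_all only: g I(1)[OF h] mult_inc_homeo inv_inc_homeo flow_inc_homeo)
  also have "\<dots> = sweep a d c (Suc j) (flow (- c 0) (1/2))"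
    unfolding sweep.simps using a(1)
    by (subst mult_H_plus_apply[OF _ _ I(1)[OF h]]) (simp_all only: mult_inc_homeo inv_inc_homeo flow_inc_homeo sweep_inc_homeo)
  finally show ?case .
qed

lemma hom_sweep_moved_at_most:
  assumes \<psi>: "\<psi> \<in> hom H_plus H_plus" and a: "a \<in> inc_homeo"
    and conj: "\<And>i. i < j \<Longrightarrow> moved_at_most
      (\<psi> ((flow (- c i) \<otimes>\<^bsub>H_plus\<^esub> a) \<otimes>\<^bsub>H_plus\<^esub> flow d \<otimes>\<^bsub>H_plus\<^esub> inv\<^bsub>H_plus\<^esub> (flow (- c i) \<otimes>\<^bsub>H_plus\<^esub> a))) e"
  shows "moved_at_most (\<psi> (sweep a d c j)) (j * e)"
  using conj
proof (induction j)
  case 0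
  then show ?case using hom_one[OF \<psi> group_H_plus group_H_plus] by (simp add: one_H_plus_apply)
next
  case (Suc j)
  let ?f = "(flow (- c j) \<otimes>\<^bsub>H_plus\<^esub> a) \<otimes>\<^bsub>H_plus\<^esub> flow d \<otimes>\<^bsub>H_plus\<^esub> inv\<^bsub>H_plus\<^esub> (flow (- c j) \<otimes>\<^bsub>H_plus\<^esub> a)"
  show ?case
  proof
    fix x :: real assume x: "x \<in> {0..1}"
    let ?y = "\<psi> (sweep a d c j) x"
    have in_hom: "\<psi> ?f \<in> inc_homeo" "\<psi> (sweep a d c j) \<in> inc_homeo"
      using \<psi> a by (auto intro!: hom_in_carrier[OF \<psi>, simplified])
    have "\<psi> (sweep a d c (Suc j)) = \<psi> ?f \<otimes>\<^bsub>H_plus\<^esub> \<psi> (sweep a d c j)"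
      using \<psi> a by (simp add: hom_mult)
    then have "\<psi> (sweep a d c (Suc j)) x = \<psi> ?f ?y"
      using in_hom x by (simp only: mult_H_plus_apply)
    moreover have "\<bar>\<psi> ?f ?y - ?y\<bar> \<le> e"
      using Suc.prems[of j] inc_homeo_in[OF in_hom(2) x] by blast
    moreover have "\<bar>?y - x\<bar> \<le> j * e" using Suc.IH Suc.prems x by (meson less_SucI)
    ultimately show "\<bar>\<psi> (sweep a d c (Suc j)) x - x\<bar> \<le> Suc j * e"
      by (simp add: algebra_simps)
  qed
qed

section \<open>Homomorphisms controlled on the flow\<close>
definition abelian_image :: "((real \<Rightarrow> real) \<Rightarrow> real \<Rightarrow> real) \<Rightarrow> real \<Rightarrow> real \<Rightarrow> bool"
  where "abelian_image \<psi> p r \<longleftrightarrow> (\<forall>g\<in>inc_homeo. \<forall>h\<in>inc_homeo.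
    supported_on g p r \<longrightarrow> supported_on h p r \<longrightarrow> \<psi> g \<otimes>\<^bsub>H_plus\<^esub> \<psi> h = \<psi> h \<otimes>\<^bsub>H_plus\<^esub> \<psi> g)"

text \<open>
  The element \<open>a\<close> depends only on the moduli of continuity of the compact sets \<open>C n\<close>, and it works
  for all homomorphisms at once. The parameter \<open>N\<close> below runs through the possible
  amounts of information on \<open>\<psi>\<close>: a time interval longer than \<open>1 / Suc N\<close>, and values in
  compact sets of index at most \<open>N\<close>. For each \<open>N\<close>, first the steepness of \<open>a\<close> at \<open>1/2\<close> is fixed;
  this determines the number \<open>w N\<close> of factors of a sweep, hence the precision \<open>e N\<close> required of each factor, and only then
  \<open>d N\<close> is chosen small enough for that precision. A homeomorphism \<open>a\<close> that realises all these
  requirements exists by \<open>ex_steep_inc_homeo\<close>. Every admissible \<open>\<psi>\<close> is covered by all large \<open>N\<close>.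
\<close>
lemma ex_collapsing_element:
  fixes C :: "nat \<Rightarrow> (real \<Rightarrow> real) set"
  assumes C: "\<And>n. compactin H_plus_top (C n)"
  shows "\<exists>a\<in>inc_homeo. \<forall>\<psi>\<in>hom H_plus H_plus. \<forall>t0 \<epsilon> n m.
    0 < \<epsilon> \<and> \<epsilon> \<le> 1 \<and> (\<forall>t\<in>{t0..t0 + \<epsilon>}. \<psi> (flow (- t)) \<in> C n) \<and> \<psi> a \<in> C m \<longrightarrow>
    abelian_image \<psi> (flow (- (t0 + \<epsilon>)) (1/2)) (flow (- t0) (1/2))"
proof -
  define D where "D N = (\<Union>n\<le>N. C n)" for N
  \<comment> \<open>Making the sets increasing allows one modulus per \<open>N\<close> to serve all smaller indices.\<close>
  have D: "compactin H_plus_top (D N)" for N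
    unfolding D_def by (intro compactin_Union) (use C in auto)
  have "\<exists>d. e > 0 \<longrightarrow> d > 0 \<and> (\<forall>f\<in>D N. \<forall>x\<in>{0..1}. \<forall>y\<in>{0..1}. \<bar>x - y\<bar> \<le> d \<longrightarrow> \<bar>f x - f y\<bar> \<le> e)"
    for N and e :: real
  proof (cases "e > 0")
    case True
    then show ?thesis by (rule compactin_H_plus_top_equicontinuous[OF D[of N]]) blast
  qed auto
  then have "\<exists>\<Omega>. \<forall>N e. e > 0 \<longrightarrow> \<Omega> N e > 0 \<and>
      (\<forall>f\<in>D N. \<forall>x\<in>{0..1}. \<forall>y\<in>{0..1}. \<bar>x - y\<bar> \<le> \<Omega> N e \<longrightarrow> \<bar>f x - f y\<bar> \<le> e)"
    by (intro choice allI)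
  then obtain \<Omega> where \<Omega>_pos: "\<And>N e. e > 0 \<Longrightarrow> \<Omega> N e > (0::real)"
    and \<Omega>: "\<And>N e f x y. e > 0 \<Longrightarrow> f \<in> D N \<Longrightarrow> x \<in> {0..1} \<Longrightarrow> y \<in> {0..1} \<Longrightarrow> \<bar>x - y\<bar> \<le> \<Omega> N e \<Longrightarrow>
      \<bar>f x - f y\<bar> \<le> e"
    by blast
  have "\<exists>w::nat. (0::nat) < w \<and> flow (1 / w) (1/2) \<le> 1/2 + (1 - 1/2) / 2^(N+2)" for N
    by (rule ex_flow_small_step[of "1/2 + (1 - 1/2) / 2^(N+2)"]) auto
  then obtain w :: "nat \<Rightarrow> nat" where w: "\<And>N. w N > 0"
    "\<And>N. flow (1 / w N) (1/2) \<le> 1/2 + (1 - 1/2) / 2^(N+2)"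
    by metis
  define e where "e N = 1 / (real (Suc N) * w N)" for N
  have e: "e N > 0" for N using w by (simp add: e_def)
  \<comment> \<open>The modulus is applied three times: to pull back along the orbit, then to pass through
    \<open>\<psi> a\<close> and \<open>\<psi> (flow (- c i))\<close>, by which \<open>\<psi> (flow d)\<close> is conjugated.\<close>
  define F where "F N = \<Omega> N (\<Omega> N (\<Omega> N (e N)))" for N
  have F: "F N > 0" for N by (simp add: F_def \<Omega>_pos e)
  have "\<exists>M::nat. (0::nat) < M \<and> 1 / M \<le> F N" for N
    using reals_Archimedean[OF F[of N]] by (metis inverse_eq_divide less_imp_le zero_less_Suc)
  then obtain M :: "nat \<Rightarrow> nat" where M: "\<And>N. M N > 0" "\<And>N. 1 / M N \<le> F N" by metis
  \<comment> \<open>So \<open>M N\<close> steps of length \<open>d N\<close> fit into a time interval of length \<open>1 / Suc N\<close>.\<close>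
  define d where "d N = 1 / (real (Suc N) * M N)" for N
  have d: "d N > 0" for N using M by (simp add: d_def)
  have half: "(1/2::real) \<in> {0..1}" by simp
  have "1/2 < flow (d N) (1/2)" for N
    using flow_strict_mono[OF _ _ d, of "1/2" N] by (simp add: flow_0 one_H_plus_apply)
  then obtain a where a: "a \<in> inc_homeo" "supported_on a (1/2) 1"
    "\<And>N. flow (d N) (1/2) \<le> 1 \<Longrightarrow> a (flow (d N) (1/2)) \<ge> 1/2 + (1 - 1/2) / 2 ^ (N + 2)"
    using ex_steep_inc_homeo[of "1/2" 1 "\<lambda>N. flow (d N) (1/2)"] by (auto simp del: power_Suc)
  have a_half: "a (1/2) = 1/2" using a(2) half unfolding supported_on_def by fastforce
  have steep: "flow (1 / w N) (1/2) \<le> a (flow (d N) (1/2))" for N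
    using a(3)[of N] w(2)[of N] inc_homeo_in[OF flow_inc_homeo half] by (meson atLeastAtMost_iff order_trans)
  show ?thesis
  proof (rule bexI[OF _ a(1)], intro ballI allI impI)
    fix \<psi> t0 \<epsilon> n m
    assume \<psi>: "\<psi> \<in> hom H_plus H_plus"
      and "0 < \<epsilon> \<and> \<epsilon> \<le> (1::real) \<and> (\<forall>t\<in>{t0..t0 + \<epsilon>}. \<psi> (flow (- t)) \<in> C n) \<and> \<psi> a \<in> C m"
    then have \<epsilon>: "0 < \<epsilon>" "\<epsilon> \<le> 1" and \<psi>_a: "\<psi> a \<in> C m"
      and \<psi>_flow: "\<And>t. t \<in> {t0..t0 + \<epsilon>} \<Longrightarrow> \<psi> (flow (- t)) \<in> C n"
      by blast+
    let ?p = "flow (- (t0 + \<epsilon>)) (1/2)" and ?r = "flow (- t0) (1/2)"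
    interpret \<psi>: group_hom H_plus H_plus \<psi>
      by (intro group_hom.intro group_hom_axioms.intro group_H_plus \<psi>)
    have \<psi>_in: "\<psi> f \<in> inc_homeo" if "f \<in> inc_homeo" for f using \<psi>.hom_closed that by simp
    have pr: "?p \<in> {0..1}" "?r \<in> {0..1}" by (intro inc_homeo_in[OF _ half] flow_inc_homeo)+
    have \<psi>_add: "\<psi> (flow (s + t)) = \<psi> (flow s) \<otimes>\<^bsub>H_plus\<^esub> \<psi> (flow t)" for s t
      using \<psi>.hom_mult[of "flow s" "flow t"] by (simp add: flow_add)
    have \<psi>_0: "\<psi> (flow 0) = \<one>\<^bsub>H_plus\<^esub>" by (simp add: flow_0)
    show "abelian_image \<psi> ?p ?r"
      unfolding abelian_image_def
    proof (intro ballI impI)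
      fix g h
      assume "g \<in> inc_homeo" "h \<in> inc_homeo" "supported_on g ?p ?r" "supported_on h ?p ?r"
      then have g: "g \<in> inc_homeo" "supported_on g ?p ?r" and h: "h \<in> inc_homeo" "supported_on h ?p ?r"
        by auto
      show "\<psi> g \<otimes>\<^bsub>H_plus\<^esub> \<psi> h = \<psi> h \<otimes>\<^bsub>H_plus\<^esub> \<psi> g"
      proof (rule commute_of_commute_with_conj[OF \<psi>_in[OF g(1)] \<psi>_in[OF h(1)]])
        fix s :: real assume s: "s > 0"
        obtain N1 :: nat where "1 / s < N1" using reals_Archimedean2 by blast
        moreover obtain N2 :: nat where "1 / \<epsilon> < N2" using reals_Archimedean2 by blast
        moreover define N where "N = Max {n, m, N1, N2}"
        ultimately have N: "n \<le> N" "m \<le> N" "1 / s < Suc N" "1 / \<epsilon> < Suc N"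
          by (auto simp: le_max_iff_disj)
        have N': "1 / Suc N < s" "1 / Suc N < \<epsilon>"
          using N(3,4) s \<epsilon> by (auto simp: field_simps)
        have \<psi>_flow_D: "\<psi> (flow (- t)) \<in> D N" if "t \<in> {t0..t0 + \<epsilon>}" for t
          using \<psi>_flow[OF that] N(1) by (auto simp: D_def)
        have \<psi>_a_D: "\<psi> a \<in> D N" using \<psi>_a N(2) by (auto simp: D_def)
        have Md: "M N * d N \<le> \<epsilon>" using N'(2) M(1)[of N] by (simp add: d_def)
        have A: "moved_at_most (\<psi> (flow (d N))) (\<Omega> N (\<Omega> N (e N)))"
        proof (rule moved_at_most_one_parameter[OF \<psi>_in[OF flow_inc_homeo] \<psi>_add \<psi>_0 M(1) less_imp_le[OF d]])
          fix t x y :: real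
          assume t: "t \<in> {t0..t0 + M N * d N}" and xy: "x \<in> {0..1}" "y \<in> {0..1}" "\<bar>x - y\<bar> \<le> 1 / M N"
          have mem: "\<psi> (flow (- t)) \<in> D N" using t Md by (intro \<psi>_flow_D) auto
          have "\<bar>x - y\<bar> \<le> \<Omega> N (\<Omega> N (\<Omega> N (e N)))" using xy(3) M(2)[of N] unfolding F_def by linarith
          then show "\<bar>\<psi> (flow (- t)) x - \<psi> (flow (- t)) y\<bar> \<le> \<Omega> N (\<Omega> N (e N))"
            by (rule \<Omega>[OF \<Omega>_pos[OF \<Omega>_pos[OF e]] mem xy(1,2)])
        qed
        \<comment> \<open>The times run down from \<open>t0 + \<epsilon>\<close> and stop at \<open>t0\<close>, which is reached after \<open>w N\<close> steps
          because \<open>\<epsilon> \<le> 1\<close>; in this way they never leave the interval in which \<open>\<psi>\<close> is controlled.\<close>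
        define c where "c j = t0 + max 0 (\<epsilon> - j * (1 / w N))" for j :: nat
        have c: "c j \<in> {t0..t0 + \<epsilon>}" for j using \<epsilon> by (auto simp: c_def)
        define u where "u = sweep a (d N) c (w N)"
        have u: "u \<in> inc_homeo" using a by (simp add: u_def)
        have "moved_at_most (\<psi> u) (w N * e N)"
          unfolding u_def
        proof (rule hom_sweep_moved_at_most[OF \<psi> a(1)])
          fix i
          have eq: "\<psi> ((flow (- c i) \<otimes>\<^bsub>H_plus\<^esub> a) \<otimes>\<^bsub>H_plus\<^esub> flow (d N) \<otimes>\<^bsub>H_plus\<^esub> inv\<^bsub>H_plus\<^esub> (flow (- c i) \<otimes>\<^bsub>H_plus\<^esub> a)) =
            \<psi> (flow (- c i) \<otimes>\<^bsub>H_plus\<^esub> a) \<otimes>\<^bsub>H_plus\<^esub> \<psi> (flow (d N)) \<otimes>\<^bsub>H_plus\<^esub> inv\<^bsub>H_plus\<^esub> \<psi> (flow (- c i) \<otimes>\<^bsub>H_plus\<^esub> a)"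
            using a by simp
          show "moved_at_most (\<psi> ((flow (- c i) \<otimes>\<^bsub>H_plus\<^esub> a) \<otimes>\<^bsub>H_plus\<^esub> flow (d N) \<otimes>\<^bsub>H_plus\<^esub>
            inv\<^bsub>H_plus\<^esub> (flow (- c i) \<otimes>\<^bsub>H_plus\<^esub> a))) (e N)"
            unfolding eq
          proof (rule moved_at_most_conj[OF _ _ A])
            fix x y :: real assume xy: "x \<in> {0..1}" "y \<in> {0..1}" "\<bar>x - y\<bar> \<le> \<Omega> N (\<Omega> N (e N))"
            have "\<bar>\<psi> a x - \<psi> a y\<bar> \<le> \<Omega> N (e N)" by (rule \<Omega>[OF \<Omega>_pos[OF e] \<psi>_a_D xy])
            then have "\<bar>\<psi> (flow (- c i)) (\<psi> a x) - \<psi> (flow (- c i)) (\<psi> a y)\<bar> \<le> e N"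
              by (rule \<Omega>[OF e \<psi>_flow_D[OF c] inc_homeo_in[OF \<psi>_in[OF a(1)] xy(1)] inc_homeo_in[OF \<psi>_in[OF a(1)] xy(2)]])
            then show "\<bar>\<psi> (flow (- c i) \<otimes>\<^bsub>H_plus\<^esub> a) x - \<psi> (flow (- c i) \<otimes>\<^bsub>H_plus\<^esub> a) y\<bar> \<le> e N"
              using a xy by (simp add: mult_H_plus_apply \<psi>_in)
          qed (use a(1) in \<open>simp_all add: \<psi>_in\<close>)
        qed
        moreover have "w N * e N \<le> s" using w(1)[of N] N'(1) by (simp add: e_def)
        ultimately have \<psi>_u: "moved_at_most (\<psi> u) s" by (meson order_trans)
        have "flow (- c (w N)) (1/2) \<le> u (flow (- c 0) (1/2))"
          unfolding u_def
        proof (rule sweep_moves_far[OF a(1) a_half steep])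
          fix j
          have "real (Suc j) * (1 / w N) = real j * (1 / w N) + 1 / w N" "0 \<le> 1 / real (w N)"
            by (simp_all add: add_divide_distrib)
          then show "c j - 1 / w N \<le> c (Suc j)" unfolding c_def by linarith
        qed
        moreover have "c (w N) = t0" "c 0 = t0 + \<epsilon>" using \<epsilon> w(1)[of N] by (auto simp: c_def)
        ultimately have far: "?r \<le> u ?p" by simp
        let ?k = "u \<otimes>\<^bsub>H_plus\<^esub> h \<otimes>\<^bsub>H_plus\<^esub> inv\<^bsub>H_plus\<^esub> u"
        have "g \<otimes>\<^bsub>H_plus\<^esub> ?k = ?k \<otimes>\<^bsub>H_plus\<^esub> g"
          using u h(1) by (intro disjoint_supports_commute[OF g _ supported_on_conj[OF u h pr] far pr]
              inc_homeo_in[OF u] pr) simp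
        then have "\<psi> (g \<otimes>\<^bsub>H_plus\<^esub> ?k) = \<psi> (?k \<otimes>\<^bsub>H_plus\<^esub> g)" by simp
        then have "\<psi> g \<otimes>\<^bsub>H_plus\<^esub> (\<psi> u \<otimes>\<^bsub>H_plus\<^esub> \<psi> h \<otimes>\<^bsub>H_plus\<^esub> inv\<^bsub>H_plus\<^esub> \<psi> u) =
            (\<psi> u \<otimes>\<^bsub>H_plus\<^esub> \<psi> h \<otimes>\<^bsub>H_plus\<^esub> inv\<^bsub>H_plus\<^esub> \<psi> u) \<otimes>\<^bsub>H_plus\<^esub> \<psi> g"
          using u g(1) h(1) by simp
        then show "\<exists>v\<in>inc_homeo. moved_at_most v s \<and>
            \<psi> g \<otimes>\<^bsub>H_plus\<^esub> (v \<otimes>\<^bsub>H_plus\<^esub> \<psi> h \<otimes>\<^bsub>H_plus\<^esub> inv\<^bsub>H_plus\<^esub> v) =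
            (v \<otimes>\<^bsub>H_plus\<^esub> \<psi> h \<otimes>\<^bsub>H_plus\<^esub> inv\<^bsub>H_plus\<^esub> v) \<otimes>\<^bsub>H_plus\<^esub> \<psi> g"
          using \<psi>_u \<psi>_in[OF u] by blast
      qed
    qed
  qed
qed

text \<open>
  A homeomorphism \<open>g\<close> that is steeper at \<open>q\<close> than every modulus of continuity occurring among the sets
  \<open>C n\<close> lies outside all of them, and \<open>g\<close> can be replaced by a commutator: if \<open>h\<close> moves the support
  \<open>(q,s)\<close> of \<open>g\<close> off itself to the right, then \<open>[g,h]\<close> agrees with \<open>g\<close> on \<open>[0,s]\<close>.
\<close>
lemma ex_commutator_outside_K_sigma:
  fixes C :: "nat \<Rightarrow> (real \<Rightarrow> real) set"
  assumes C: "\<And>n. compactin H_plus_top (C n)" and pr: "0 \<le> p" "p < r" "r \<le> 1"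
  obtains g h where "g \<in> inc_homeo" "supported_on g p r" "h \<in> inc_homeo" "supported_on h p r"
    "g \<otimes>\<^bsub>H_plus\<^esub> (h \<otimes>\<^bsub>H_plus\<^esub> inv\<^bsub>H_plus\<^esub> g \<otimes>\<^bsub>H_plus\<^esub> inv\<^bsub>H_plus\<^esub> h) \<notin> (\<Union>n. C n)"
proof -
  \<comment> \<open>\<open>s\<close> is the lower bound that \<open>ex_steep_inc_homeo\<close> gives for \<open>h q\<close>, wherever \<open>q\<close> is.\<close>
  define q where "q = p + (r - p) / 8"
  define s where "s = p + (r - p) / 4"
  have qs: "p < q" "q < s" "s < r" "q \<in> {0..1}" "s \<in> {0..1}"
    using pr by (auto simp: q_def s_def field_simps)
  obtain h where h: "h \<in> inc_homeo" "supported_on h p r" "s \<le> h q"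
  proof (rule ex_steep_inc_homeo[OF pr, of "\<lambda>_. q"])
    fix h assume "h \<in> inc_homeo" "supported_on h p r" and "\<And>k. q \<le> 1 \<Longrightarrow> p + (r - p) / 2 ^ (k + 2) \<le> h q"
    from this(3)[of 0] this(1,2) show thesis using qs(4) by (intro that) (auto simp: s_def)
  qed (use qs in auto)
  have "\<exists>d>0. \<forall>f\<in>C n. \<forall>x\<in>{0..1}. \<forall>y\<in>{0..1}. \<bar>x - y\<bar> \<le> d \<longrightarrow> \<bar>f x - f y\<bar> \<le> (s - q) / 2^(n+3)" for n
    by (rule compactin_H_plus_top_equicontinuous[OF C[of n], of "(s - q) / 2^(n+3)"]) (use qs in auto)
  then obtain d where d: "\<And>n. d n > (0::real)"
    "\<And>n f x y. f \<in> C n \<Longrightarrow> x \<in> {0..1} \<Longrightarrow> y \<in> {0..1} \<Longrightarrow> \<bar>x - y\<bar> \<le> d n \<Longrightarrow> \<bar>f x - f y\<bar> \<le> (s - q) / 2^(n+3)"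
    by metis
  define x where "x n = min (q + d n) s" for n
  have x: "q < x n" "x n \<in> {0..1}" "x n \<le> s" "\<bar>x n - q\<bar> \<le> d n" for n using d(1)[of n] qs by (auto simp: x_def)
  obtain g where g: "g \<in> inc_homeo" "supported_on g q s" "\<And>n. g (x n) \<ge> q + (s - q) / 2^(n+2)"
    using ex_steep_inc_homeo[of q s x] qs x by (metis atLeastAtMost_iff)
  have g_pr: "supported_on g p r" using g(2) qs by (auto simp: supported_on_def)
  let ?c = "g \<otimes>\<^bsub>H_plus\<^esub> (h \<otimes>\<^bsub>H_plus\<^esub> inv\<^bsub>H_plus\<^esub> g \<otimes>\<^bsub>H_plus\<^esub> inv\<^bsub>H_plus\<^esub> h)"
  have c: "?c y = g y" if y: "y \<in> {0..1}" "y \<le> s" for y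
  proof -
    have "supported_on (h \<otimes>\<^bsub>H_plus\<^esub> inv\<^bsub>H_plus\<^esub> g \<otimes>\<^bsub>H_plus\<^esub> inv\<^bsub>H_plus\<^esub> h) (h q) (h s)"
      using g h qs by (intro supported_on_conj supported_on_inv) auto
    then have "(h \<otimes>\<^bsub>H_plus\<^esub> inv\<^bsub>H_plus\<^esub> g \<otimes>\<^bsub>H_plus\<^esub> inv\<^bsub>H_plus\<^esub> h) y = y"
      using y h(3) by (auto simp: supported_on_def)
    moreover have "?c y = g ((h \<otimes>\<^bsub>H_plus\<^esub> inv\<^bsub>H_plus\<^esub> g \<otimes>\<^bsub>H_plus\<^esub> inv\<^bsub>H_plus\<^esub> h) y)"
      using g h by (intro mult_H_plus_apply y) auto
    ultimately show ?thesis by simp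
  qed
  have "?c \<notin> C n" for n
  proof
    assume "?c \<in> C n"
    then have "\<bar>?c (x n) - ?c q\<bar> \<le> (s - q) / 2^(n+3)" using x qs by (intro d(2)) auto
    moreover have "?c q = q" using c[of q] qs g(2) by (auto simp: supported_on_def)
    moreover have "?c (x n) \<ge> q + (s - q) / 2^(n+2)" using c[of "x n"] x g(3) by metis
    moreover have "(s - q) / 2^(n+3) < (s - q) / 2^(n+2)"
      using qs by (intro divide_strict_left_mono power_strict_increasing) auto
    ultimately show False by linarith
  qed
  then show thesis using that[OF g(1) g_pr h(1,2)] by blast
qed

section \<open>Subgroups generated by \<open>K_\<sigma>\<close> sets\<close>
lemma K_sigma_in_iff_sequence:
  "K_sigma_in T A \<longleftrightarrow> (\<exists>K :: nat \<Rightarrow> _. (\<forall>n. compactin T (K n)) \<and> A = (\<Union>n. K n))"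
proof
  assume "K_sigma_in T A"
  then obtain \<U> where \<U>: "countable \<U>" "\<And>K. K \<in> \<U> \<Longrightarrow> compactin T K" "A = \<Union>\<U>"
    by (auto simp: K_sigma_in_def union_of_def)
  have "range (from_nat_into (insert {} \<U>)) = insert {} \<U>"
    using \<U>(1) by (intro range_from_nat_into) auto
  then show "\<exists>K :: nat \<Rightarrow> _. (\<forall>n. compactin T (K n)) \<and> A = (\<Union>n. K n)"
    using \<U>(2,3) by (intro exI[of _ "from_nat_into (insert {} \<U>)"] conjI allI)
      (metis compactin_empty insert_iff rangeI, simp)
next
  assume "\<exists>K :: nat \<Rightarrow> _. (\<forall>n. compactin T (K n)) \<and> A = (\<Union>n. K n)"
  then obtain K :: "nat \<Rightarrow> _" where "\<forall>n. compactin T (K n)" "A = (\<Union>n. K n)" by blast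
  then show "K_sigma_in T A"
    unfolding K_sigma_in_def union_of_def by (intro exI[of _ "range K"]) auto
qed

lemma K_sigma_in_UN:
  assumes "countable I" "\<And>i. i \<in> I \<Longrightarrow> K_sigma_in T (A i)"
  shows "K_sigma_in T (\<Union>i\<in>I. A i)"
proof -
  have "\<forall>i\<in>I. \<exists>\<U>. countable \<U> \<and> \<U> \<subseteq> Collect (compactin T) \<and> \<Union>\<U> = A i"
    using assms(2) by (simp add: K_sigma_in_def union_of_def)
  then obtain \<U> where \<U>: "\<And>i. i \<in> I \<Longrightarrow> countable (\<U> i)"
    "\<And>i. i \<in> I \<Longrightarrow> \<U> i \<subseteq> Collect (compactin T)" "\<And>i. i \<in> I \<Longrightarrow> \<Union>(\<U> i) = A i"
    by metis
  have "\<Union>(\<Union>i\<in>I. \<U> i) = (\<Union>i\<in>I. \<Union>(\<U> i))" by auto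
  also have "\<dots> = (\<Union>i\<in>I. A i)" using \<U>(3) by simp
  finally have "\<Union>(\<Union>i\<in>I. \<U> i) = (\<Union>i\<in>I. A i)" .
  moreover have "countable (\<Union>i\<in>I. \<U> i)" using assms(1) \<U>(1) by auto
  moreover have "(\<Union>i\<in>I. \<U> i) \<subseteq> Collect (compactin T)" using \<U>(2) by blast
  ultimately show ?thesis unfolding K_sigma_in_def union_of_def by blast
qed

lemma compactin_imp_K_sigma_in: "compactin T A \<Longrightarrow> K_sigma_in T A"
  by (auto simp: K_sigma_in_iff_sequence)

lemma K_sigma_in_image:
  assumes "K_sigma_in T A" "continuous_map T T' f"
  shows "K_sigma_in T' (f ` A)"
proof -
  obtain K :: "nat \<Rightarrow> _" where "\<And>n. compactin T (K n)" "A = (\<Union>n. K n)"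
    using assms(1) by (auto simp: K_sigma_in_iff_sequence)
  then show ?thesis
    using assms(2) unfolding K_sigma_in_iff_sequence
    by (intro exI[of _ "\<lambda>n. f ` K n"]) (auto intro: image_compactin)
qed

lemma K_sigma_in_Times:
  assumes "K_sigma_in T A" "K_sigma_in T' B"
  shows "K_sigma_in (prod_topology T T') (A \<times> B)"
proof -
  obtain K K' where K: "\<And>n::nat. compactin T (K n)" "A = (\<Union>n. K n)"
    and K': "\<And>n::nat. compactin T' (K' n)" "B = (\<Union>n. K' n)"
    using assms by (auto simp: K_sigma_in_iff_sequence)
  have "A \<times> B = (\<Union>(m, n)\<in>UNIV. K m \<times> K' n)" using K K' by auto
  moreover have "K_sigma_in (prod_topology T T') (\<Union>(m, n)\<in>UNIV. K m \<times> K' n)"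
    by (rule K_sigma_in_UN) (auto intro!: compactin_imp_K_sigma_in simp: compactin_Times K K')
  ultimately show ?thesis by simp
qed

text \<open>
  Squaring at each step, rather than multiplying by \<open>S\<close>, makes the union closed under products
  without any bookkeeping of word lengths.
\<close>
primrec iterated_products :: "('a, 'b) monoid_scheme \<Rightarrow> 'a set \<Rightarrow> nat \<Rightarrow> 'a set"
  where "iterated_products G S 0 = S"
  | "iterated_products G S (Suc n) = iterated_products G S n <#>\<^bsub>G\<^esub> iterated_products G S n"

lemma (in group) subgroup_UN_iterated_products:
  assumes S: "S \<subseteq> carrier G" "\<one> \<in> S" "\<And>x. x \<in> S \<Longrightarrow> inv x \<in> S"
  shows "subgroup (\<Union>n. iterated_products G S n) G"
proof -
  let ?P = "iterated_products G S"
  have sub: "?P n \<subseteq> carrier G" for n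
    by (induction n) (use S in \<open>auto simp: set_mult_def\<close>)
  have one: "\<one> \<in> ?P n" for n
    by (induction n) (use S in \<open>force simp: set_mult_def\<close>)+
  have inv: "inv x \<in> ?P n" if "x \<in> ?P n" for x n
    using that
  proof (induction n arbitrary: x)
    case (Suc n)
    then obtain y z where "y \<in> ?P n" "z \<in> ?P n" "x = y \<otimes> z" by (auto simp: set_mult_def)
    with Suc.IH sub[of n] show ?case by (auto simp: set_mult_def inv_mult_group subset_iff)
  qed (use S in auto)
  have "?P n \<subseteq> ?P (Suc n)" for n
  proof
    fix x assume "x \<in> ?P n"
    then show "x \<in> ?P (Suc n)" using sub[of n] one[of n] by (force simp: set_mult_def)
  qed
  then have mono: "?P m \<subseteq> ?P n" if "m \<le> n" for m n using lift_Suc_mono_le[of ?P] that by blast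
  show ?thesis
  proof (rule subgroupI)
    fix x y assume "x \<in> (\<Union>n. ?P n)" "y \<in> (\<Union>n. ?P n)"
    then obtain m n where "x \<in> ?P m" "y \<in> ?P n" by auto
    then have "x \<in> ?P (max m n)" "y \<in> ?P (max m n)" using mono[of m "max m n"] mono[of n "max m n"] by auto
    then have "x \<otimes> y \<in> ?P (Suc (max m n))" by (auto simp: set_mult_def)
    then show "x \<otimes> y \<in> (\<Union>n. ?P n)" by blast
  qed (use sub one inv in blast)+
qed

lemma (in group) ex_K_sigma_subgroup_superset:
  assumes mult: "continuous_map (prod_topology T T) T (\<lambda>(x, y). x \<otimes> y)"
    and S: "K_sigma_in T S" "S \<subseteq> carrier G" "\<one> \<in> S" "\<And>x. x \<in> S \<Longrightarrow> inv x \<in> S"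
  shows "\<exists>\<Gamma>. K_sigma_subgroup \<Gamma> G T \<and> S \<subseteq> \<Gamma>"
proof (intro exI conjI)
  have "K_sigma_in T (iterated_products G S n)" for n
  proof (induction n)
    case (Suc n)
    have "A <#> B = (\<lambda>(x, y). x \<otimes> y) ` (A \<times> B)" for A B by (auto simp: set_mult_def)
    then show ?case using K_sigma_in_image[OF K_sigma_in_Times[OF Suc Suc] mult] by simp
  qed (use S in simp)
  then have "K_sigma_in T (\<Union>n. iterated_products G S n)" by (intro K_sigma_in_UN) auto
  then show "K_sigma_subgroup (\<Union>n. iterated_products G S n) G T"
    using subgroup_UN_iterated_products S(2-4) by (simp add: K_sigma_subgroup_def)
  show "S \<subseteq> (\<Union>n. iterated_products G S n)" using iterated_products.simps(1)[of G S] by blast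
qed

section \<open>The Baire argument and the first factor\<close>
lemma ex_interval_in_compact:
  fixes F :: "real \<Rightarrow> 'a"
  assumes F: "continuous_map euclideanreal T F" and T: "Hausdorff_space T"
    and K: "\<And>n::nat. compactin T (K n)" and cov: "\<And>t. F t \<in> (\<Union>n. K n)"
  shows "\<exists>n t0 \<epsilon>. 0 < \<epsilon> \<and> \<epsilon> \<le> 1 \<and> (\<forall>t\<in>{t0..t0 + \<epsilon>}. F t \<in> K n)"
proof -
  have cl: "closedin euclideanreal (F -` K n)" for n
    using closedin_continuous_map_preimage[OF F compactin_imp_closedin[OF T K[of n]]] by (simp add: vimage_def)
  have "\<exists>n. interior (F -` K n) \<noteq> {}"
  proof (rule ccontr)
    assume "\<not> ?thesis"
    then have "euclideanreal interior_of \<Union>(range (\<lambda>n. F -` K n)) = {}"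
      using cl by (intro Baire_category_alt disjI1 completely_metrizable_space_euclidean) auto
    moreover have "\<Union>(range (\<lambda>n. F -` K n)) = UNIV" using cov by auto
    ultimately show False by simp
  qed
  then obtain n t0 where "t0 \<in> interior (F -` K n)" by auto
  then obtain e where e: "e > 0" "ball t0 e \<subseteq> F -` K n" by (auto simp: mem_interior)
  have "F t \<in> K n" if "t \<in> {t0..t0 + min 1 (e/2)}" for t
  proof -
    have "t \<in> ball t0 e" using that e(1) by (auto simp: dist_real_def)
    then show ?thesis using e(2) by auto
  qed
  then show ?thesis using e(1) by (intro exI[of _ n] exI[of _ t0] exI[of _ "min 1 (e/2)"]) auto
qed

lemma Hausdorff_H_plus_N_top: "Hausdorff_space H_plus_N_top"
proof -
  have "Hausdorff_space H_plus_top"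
    unfolding H_plus_top_def mtopology_of_def
    by (intro Hausdorff_space_subtopology Metric_space.Hausdorff_space_mtopology Metric_space_mspace_mdist)
  then show ?thesis by (simp add: H_plus_N_top_def Hausdorff_space_product_topology)
qed

definition first_factor :: "(real \<Rightarrow> real) \<Rightarrow> nat \<Rightarrow> real \<Rightarrow> real"
  where "first_factor f = (\<lambda>i. if i = 0 then f else \<one>\<^bsub>H_plus\<^esub>)"

lemma first_factor_hom: "first_factor \<in> hom H_plus H_plus_N"
  by (rule homI) (auto simp: first_factor_def H_plus_N_def)

lemma continuous_map_first_factor: "continuous_map H_plus_top H_plus_N_top first_factor"
  unfolding H_plus_N_top_def continuous_map_componentwise_UNIV
proof
  fix i show "continuous_map H_plus_top H_plus_top (\<lambda>f. first_factor f i)"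
    by (cases "i = 0") (auto simp: first_factor_def)
qed

lemma first_factor_inject: "first_factor f = first_factor g \<Longrightarrow> f = g"
  by (metis first_factor_def)

lemma coordinate_hom: "(\<lambda>x. x i) \<in> hom H_plus_N H_plus"
  by (rule homI) (auto simp: H_plus_N_def)

lemma continuous_map_coordinate: "continuous_map H_plus_N_top H_plus_top (\<lambda>x. x i)"
  unfolding H_plus_N_top_def by (rule continuous_map_product_coordinates) simp

section \<open>The theorem\<close>
theorem corollary1p3:
  shows "\<nexists>L. universal_K_sigma_subgroup L H_plus_N H_plus_N_top"
proof
  assume "\<exists>L. universal_K_sigma_subgroup L H_plus_N H_plus_N_top"
  then obtain L where L: "subgroup L H_plus_N" "K_sigma_in H_plus_N_top L"
    and univ: "\<And>H. K_sigma_subgroup H H_plus_N H_plus_N_top \<Longrightarrow>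
      group_hom_reducible H_plus_N H_plus_N_top H L"
    by (auto simp: universal_K_sigma_subgroup_def K_sigma_subgroup_def)
  interpret N: group H_plus_N by (rule group_H_plus_N)
  obtain K :: "nat \<Rightarrow> _" where K: "\<And>n. compactin H_plus_N_top (K n)" "L = (\<Union>n. K n)"
    using L(2) by (auto simp: K_sigma_in_iff_sequence)
  define C where "C m = (case prod_decode m of (i, n) \<Rightarrow> (\<lambda>x. x i) ` K n)" for m
  \<comment> \<open>All coordinates of all compact parts of \<open>L\<close> form one sequence, so one \<open>a\<close> serves every coordinate.\<close>
  have C: "compactin H_plus_top (C m)" for m
    unfolding C_def using image_compactin[OF K(1) continuous_map_coordinate] by (auto split: prod.splits)
  have C_enc: "x i \<in> C (prod_encode (i, n))" if "x \<in> K n" for x i n using that by (auto simp: C_def)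
  obtain a where a: "a \<in> inc_homeo"
    and collapse: "\<forall>\<psi>\<in>hom H_plus H_plus. \<forall>t0 \<epsilon> n m.
    0 < \<epsilon> \<and> \<epsilon> \<le> 1 \<and> (\<forall>t\<in>{t0..t0 + \<epsilon>}. \<psi> (flow (- t)) \<in> C n) \<and> \<psi> a \<in> C m \<longrightarrow>
    abelian_image \<psi> (flow (- (t0 + \<epsilon>)) (1/2)) (flow (- t0) (1/2))"
    by (rule bexE[OF ex_collapsing_element[of C, OF C]])
  define S where "S = range flow \<union> {a, inv\<^bsub>H_plus\<^esub> a}"
  have "K_sigma_in euclideanreal (\<Union>n::nat. {- real n..real n})"
    by (intro K_sigma_in_UN compactin_imp_K_sigma_in) auto
  moreover have "(\<Union>n::nat. {- real n..real n}) = UNIV"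
  proof -
    have "\<exists>n::nat. - real n \<le> x \<and> x \<le> real n" for x :: real
    proof -
      obtain n :: nat where "\<bar>x\<bar> \<le> real n" using real_arch_simple by blast
      then show ?thesis by (intro exI[of _ n]) linarith
    qed
    then show ?thesis by auto
  qed
  ultimately have "K_sigma_in H_plus_top (range flow)"
    using K_sigma_in_image[OF _ continuous_map_flow] by simp
  moreover have "K_sigma_in H_plus_top {a, inv\<^bsub>H_plus\<^esub> a}"
    using a by (intro compactin_imp_K_sigma_in finite_imp_compactin) auto
  ultimately have S_K: "K_sigma_in H_plus_top S"
    using K_sigma_in_UN[of "{True, False}" H_plus_top "\<lambda>b. if b then range flow else {a, inv\<^bsub>H_plus\<^esub> a}"]
    by (simp add: S_def)
  have "\<exists>\<Gamma>. K_sigma_subgroup \<Gamma> H_plus H_plus_top \<and> S \<subseteq> \<Gamma>"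
  proof (rule HP.ex_K_sigma_subgroup_superset[OF continuous_map_mult_H_plus S_K])
    show "\<one>\<^bsub>H_plus\<^esub> \<in> S" using rangeI[of flow 0] by (simp add: S_def flow_0)
    show "inv\<^bsub>H_plus\<^esub> x \<in> S" if "x \<in> S" for x using that a by (auto simp: S_def inv_flow)
  qed (use a in \<open>auto simp: S_def\<close>)
  then obtain \<Gamma> where \<Gamma>: "subgroup \<Gamma> H_plus" "K_sigma_in H_plus_top \<Gamma>" "S \<subseteq> \<Gamma>"
    by (auto simp: K_sigma_subgroup_def)
  have "subgroup (first_factor ` \<Gamma>) H_plus_N"
    by (intro group_hom.subgroup_img_is_subgroup[OF _ \<Gamma>(1)] group_hom.intro group_hom_axioms.intro
        group_H_plus group_H_plus_N first_factor_hom)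
  then have "K_sigma_subgroup (first_factor ` \<Gamma>) H_plus_N H_plus_N_top"
    using K_sigma_in_image[OF \<Gamma>(2) continuous_map_first_factor] by (simp add: K_sigma_subgroup_def)
  from univ[OF this] obtain \<phi> where \<phi>: "\<phi> \<in> hom H_plus_N H_plus_N"
    "continuous_map H_plus_N_top H_plus_N_top \<phi>"
    "first_factor ` \<Gamma> = {x \<in> carrier H_plus_N. \<phi> x \<in> L}"
    by (auto simp: group_hom_reducible_def)
  define \<theta> where "\<theta> = \<phi> \<circ> first_factor"
  have \<theta>: "\<theta> \<in> hom H_plus H_plus_N" unfolding \<theta>_def by (rule hom_compose[OF first_factor_hom \<phi>(1)])
  have \<theta>_cont: "continuous_map H_plus_top H_plus_N_top \<theta>"
    unfolding \<theta>_def by (rule continuous_map_compose[OF continuous_map_first_factor \<phi>(2)])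
  have \<theta>_iff: "f \<in> \<Gamma> \<longleftrightarrow> \<theta> f \<in> L" if "f \<in> inc_homeo" for f
  proof -
    have "first_factor f \<in> carrier H_plus_N" using hom_in_carrier[OF first_factor_hom] that by simp
    moreover have "f \<in> \<Gamma> \<longleftrightarrow> first_factor f \<in> first_factor ` \<Gamma>" by (auto dest: first_factor_inject)
    ultimately show ?thesis using \<phi>(3) by (simp add: \<theta>_def)
  qed
  have "\<exists>n t0 \<epsilon>. 0 < \<epsilon> \<and> \<epsilon> \<le> 1 \<and> (\<forall>t\<in>{t0..t0 + \<epsilon>}. (\<theta> \<circ> flow \<circ> uminus) t \<in> K n)"
  proof (rule ex_interval_in_compact[OF _ Hausdorff_H_plus_N_top K(1)])
    have "continuous_map euclideanreal euclideanreal (uminus :: real \<Rightarrow> real)"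
      by (simp add: continuous_on_minus)
    then show "continuous_map euclideanreal H_plus_N_top (\<theta> \<circ> flow \<circ> uminus)"
      using continuous_map_compose[OF continuous_map_flow \<theta>_cont] by (rule continuous_map_compose)
    show "(\<theta> \<circ> flow \<circ> uminus) t \<in> (\<Union>n. K n)" for t
      using \<theta>_iff[of "flow (- t)"] \<Gamma>(3) K(2) by (auto simp: S_def)
  qed
  then obtain n t0 \<epsilon> where \<epsilon>: "0 < \<epsilon>" "\<epsilon> \<le> 1" "\<forall>t\<in>{t0..t0 + \<epsilon>}. \<theta> (flow (- t)) \<in> K n"
    by auto
  obtain m where m: "\<theta> a \<in> K m" using \<theta>_iff[OF a] \<Gamma>(3) K(2) by (auto simp: S_def)
  \<comment> \<open>The time interval was obtained in the power, before passing to coordinates; hence the interval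
    \<open>(?p, ?r)\<close> is the same for all coordinates.\<close>
  let ?p = "flow (- (t0 + \<epsilon>)) (1/2)" and ?r = "flow (- t0) (1/2)"
  have pr: "0 \<le> ?p" "?p < ?r" "?r \<le> 1"
    using inc_homeo_in[of "flow (- (t0 + \<epsilon>))" "1/2"] inc_homeo_in[of "flow (- t0)" "1/2"]
      flow_strict_mono[of "1/2" "- (t0 + \<epsilon>)" "- t0"] \<epsilon>(1) by auto
  obtain E :: "nat \<Rightarrow> _" where E: "\<And>n. compactin H_plus_top (E n)" "\<Gamma> = (\<Union>n. E n)"
    using \<Gamma>(2) by (auto simp: K_sigma_in_iff_sequence)
  obtain g h where g: "g \<in> inc_homeo" "supported_on g ?p ?r" and h: "h \<in> inc_homeo" "supported_on h ?p ?r"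
    and out: "g \<otimes>\<^bsub>H_plus\<^esub> (h \<otimes>\<^bsub>H_plus\<^esub> inv\<^bsub>H_plus\<^esub> g \<otimes>\<^bsub>H_plus\<^esub> inv\<^bsub>H_plus\<^esub> h) \<notin> \<Gamma>"
    by (rule ex_commutator_outside_K_sigma[of E, OF E(1) pr, folded E(2)])
  interpret \<theta>: group_hom H_plus H_plus_N \<theta>
    by (intro group_hom.intro group_hom_axioms.intro group_H_plus group_H_plus_N \<theta>)
  have "\<theta> g i \<otimes>\<^bsub>H_plus\<^esub> \<theta> h i = \<theta> h i \<otimes>\<^bsub>H_plus\<^esub> \<theta> g i" for i
  proof -
    have \<psi>: "(\<lambda>f. \<theta> f i) \<in> hom H_plus H_plus"
      using hom_compose[OF \<theta> coordinate_hom[of i]] by (simp add: comp_def)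
    have A: "\<forall>t\<in>{t0..t0 + \<epsilon>}. \<theta> (flow (- t)) i \<in> C (prod_encode (i, n))"
      using C_enc \<epsilon>(3) by simp
    have B: "\<theta> a i \<in> C (prod_encode (i, m))" by (rule C_enc[OF m])
    have "abelian_image (\<lambda>f. \<theta> f i) ?p ?r"
      by (rule mp[OF spec[OF spec[OF spec[OF spec[OF bspec[OF collapse \<psi>]]]]]
            conjI[OF \<epsilon>(1) conjI[OF \<epsilon>(2) conjI[OF A B]]]])
    then show ?thesis using g h by (simp add: abelian_image_def)
  qed
  then have comm: "\<theta> g \<otimes>\<^bsub>H_plus_N\<^esub> \<theta> h = \<theta> h \<otimes>\<^bsub>H_plus_N\<^esub> \<theta> g" by (simp add: H_plus_N_def)
  have in_N: "\<theta> g \<in> carrier H_plus_N" "\<theta> h \<in> carrier H_plus_N" using g h by auto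
  let ?c = "g \<otimes>\<^bsub>H_plus\<^esub> (h \<otimes>\<^bsub>H_plus\<^esub> inv\<^bsub>H_plus\<^esub> g \<otimes>\<^bsub>H_plus\<^esub> inv\<^bsub>H_plus\<^esub> h)"
  have "\<theta> ?c = \<theta> g \<otimes>\<^bsub>H_plus_N\<^esub> (\<theta> h \<otimes>\<^bsub>H_plus_N\<^esub> inv\<^bsub>H_plus_N\<^esub> \<theta> g \<otimes>\<^bsub>H_plus_N\<^esub> inv\<^bsub>H_plus_N\<^esub> \<theta> h)"
    using g h by simp
  also have "\<dots> = (\<theta> g \<otimes>\<^bsub>H_plus_N\<^esub> \<theta> h) \<otimes>\<^bsub>H_plus_N\<^esub> inv\<^bsub>H_plus_N\<^esub> (\<theta> h \<otimes>\<^bsub>H_plus_N\<^esub> \<theta> g)"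
    using in_N by (simp only: N.inv_mult_group N.m_assoc N.m_closed N.inv_closed)
  also have "\<dots> = \<one>\<^bsub>H_plus_N\<^esub>" unfolding comm using in_N by simp
  finally have "\<theta> ?c \<in> L" using subgroup.one_closed[OF L(1)] by simp
  then show False using \<theta>_iff[of ?c] out g h by simp
qed

end
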